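(* Let $k$ be a finite field of odd characteristic, and let $f = f_1 f_2\in k[x]$ be a separable polynomial of degree $6$, where $f_1,f_2\in k[x]$ are cubic. Let $S$ be the set of roots of $f$ in $k$, and let $T$ be the set of $j$-invariants $j(E)$ where $E$ ranges over all elliptic curves over $k$ compatible with $f_1$. For $a\in k$ with $f(a)\ne 0$ let $E_{a,1}$ be the elliptic curve $y^2 = x^3 f_1(1/x + a)$, and let $E_{\infty,1}$ be the elliptic curve $y^2 = f_1(x)$. Then the map $\mathbf{P}^1(k)\setminus S \to k$ sending $a$ to $j(E_{a,1})$ has image contained in $T$. Moreover, with at most $5$ exceptions, every element of $T$ has exactly $n(f_1)$ preimages under this map, and each exceptional element of $T$ has fewer than $n(f_1)$ preimages.
   Context: An elliptic curve $E$ over $k$ is compatible with a separable cubic $g\in k[x]$ if $E$ is isomorphic over $k$ to $y^2 = c g(x)$ for some nonzero $c\in k$, or to $y^2 = c x^3 g(1/x+a)$ for some $a,c\in k$ with $c\neq 0$. For a separable cubic $g\in k[x]$, $n(g)$ denotes the number of automorphisms of $\mathbf{P}^1_k$ (defined over $k$) that permute the roots of $g$. *)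

theory Defs
  imports
    "HOL-Algebra.Algebraic_Closure_Type"
    "HOL-Computational_Algebra.Computational_Algebra"
begin

subsection \<open>Separable polynomials\<close>

abbreviation to_closure :: "'k::field poly \<Rightarrow> 'k alg_closure poly" where
  "to_closure \<equiv> map_poly to_ac"

text \<open>No repeated root in an algebraic closure; since \<open>rsquarefree\<close> only looks at roots in
  the coefficient field, the polynomial has to be moved to the closure first.\<close>

definition separable_poly :: "'k::field poly \<Rightarrow> bool" where
  "separable_poly g \<longleftrightarrow> rsquarefree (to_closure g)"

subsection \<open>The projective line and its automorphisms\<close>

datatype 'a proj_line = Pt 'a | Infty

fun moebius :: "'a \<Rightarrow> 'a \<Rightarrow> 'a \<Rightarrow> 'a \<Rightarrow> 'a proj_line \<Rightarrow> 'a::field proj_line" where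
  "moebius a b c d (Pt x) = (if c * x + d = 0 then Infty else Pt ((a * x + b) / (c * x + d)))"
| "moebius a b c d Infty = (if c = 0 then Infty else Pt (a / c))"

text \<open>The automorphisms of the projective line defined over \<open>k\<close>, that is \<open>PGL\<^sub>2(k)\<close>, are
  represented by the maps they induce on the points over the algebraic closure, so that they
  can act on the roots of a polynomial that need not lie in \<open>k\<close>. As the closure is infinite,
  distinct elements of \<open>PGL\<^sub>2(k)\<close> give distinct maps.\<close>

definition proj_line_auts :: "('k::field alg_closure proj_line \<Rightarrow> 'k alg_closure proj_line) set" where
  "proj_line_auts =
     {moebius (to_ac a) (to_ac b) (to_ac c) (to_ac d) | a b c d :: 'k. a * d - b * c \<noteq> 0}"

definition geometric_roots :: "'k::field poly \<Rightarrow> 'k alg_closure proj_line set" where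
  "geometric_roots g = Pt ` {z. poly (to_closure g) z = 0}"

definition num_root_auts :: "'k::field poly \<Rightarrow> nat" where
  "num_root_auts g =
     card {\<phi> \<in> proj_line_auts. bij_betw \<phi> (geometric_roots g) (geometric_roots g)}"

subsection \<open>Elliptic curves\<close>

text \<open>\<open>Weierstrass a1 a2 a3 a4 a6\<close> stands for the curve
  \<open>y\<^sup>2 + a1 x y + a3 y = x\<^sup>3 + a2 x\<^sup>2 + a4 x + a6\<close>.\<close>

datatype 'a weierstrass =
  Weierstrass (wa1: 'a) (wa2: 'a) (wa3: 'a) (wa4: 'a) (wa6: 'a)

definition weq :: "'a::field weierstrass \<Rightarrow> 'a \<Rightarrow> 'a \<Rightarrow> 'a" where
  "weq E x y = y^2 + wa1 E * x * y + wa3 E * y - (x^3 + wa2 E * x^2 + wa4 E * x + wa6 E)"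

definition wb2 :: "'a::field weierstrass \<Rightarrow> 'a" where
  "wb2 E = wa1 E ^ 2 + 4 * wa2 E"

definition wb4 :: "'a::field weierstrass \<Rightarrow> 'a" where
  "wb4 E = 2 * wa4 E + wa1 E * wa3 E"

definition wb6 :: "'a::field weierstrass \<Rightarrow> 'a" where
  "wb6 E = wa3 E ^ 2 + 4 * wa6 E"

definition wb8 :: "'a::field weierstrass \<Rightarrow> 'a" where
  "wb8 E = wa1 E ^ 2 * wa6 E + 4 * wa2 E * wa6 E - wa1 E * wa3 E * wa4 E
           + wa2 E * wa3 E ^ 2 - wa4 E ^ 2"

definition wc4 :: "'a::field weierstrass \<Rightarrow> 'a" where
  "wc4 E = wb2 E ^ 2 - 24 * wb4 E"

definition wdisc :: "'a::field weierstrass \<Rightarrow> 'a" where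
  "wdisc E = - (wb2 E ^ 2 * wb8 E) - 8 * wb4 E ^ 3 - 27 * wb6 E ^ 2 + 9 * wb2 E * wb4 E * wb6 E"

definition elliptic_curve :: "'a::field weierstrass \<Rightarrow> bool" where
  "elliptic_curve E \<longleftrightarrow> wdisc E \<noteq> 0"

definition j_invariant :: "'a::field weierstrass \<Rightarrow> 'a" where
  "j_invariant E = wc4 E ^ 3 / wdisc E"

text \<open>The equation obtained from that of \<open>E\<close> by substituting
  \<open>x = u\<^sup>2 x' + r\<close>, \<open>y = u\<^sup>3 y' + s u\<^sup>2 x' + t\<close> and dividing by \<open>u\<^sup>6\<close>
  (Silverman, The Arithmetic of Elliptic Curves, Table 3.1).
  Two elliptic curves over \<open>k\<close> are isomorphic over \<open>k\<close> iff they are related by such a change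
  of variables with \<open>u, r, s, t\<close> in \<open>k\<close> (ibid., Proposition III.3.1).\<close>

definition change_vars :: "'a::field \<Rightarrow> 'a \<Rightarrow> 'a \<Rightarrow> 'a \<Rightarrow> 'a weierstrass \<Rightarrow> 'a weierstrass" where
  "change_vars u r s t E = Weierstrass
     ((wa1 E + 2 * s) / u)
     ((wa2 E - s * wa1 E + 3 * r - s^2) / u^2)
     ((wa3 E + r * wa1 E + 2 * t) / u^3)
     ((wa4 E - s * wa3 E + 2 * r * wa2 E - (t + r * s) * wa1 E + 3 * r^2 - 2 * s * t) / u^4)
     ((wa6 E + r * wa4 E + r^2 * wa2 E + r^3 - t * wa3 E - t^2 - r * t * wa1 E) / u^6)"

lemma weq_change_vars:
  assumes "u \<noteq> 0"
  shows "weq E (u^2 * x + r) (u^3 * y + s * u^2 * x + t) = u^6 * weq (change_vars u r s t E) x y"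
proof -
  have *: "u^6 * weq (Weierstrass (A1 / u) (A2 / u^2) (A3 / u^3) (A4 / u^4) (A6 / u^6)) x y =
      u^6 * y^2 + A1 * u^5 * x * y + A3 * u^3 * y
        - (u^6 * x^3 + A2 * u^4 * x^2 + A4 * u^2 * x + A6)" for A1 A2 A3 A4 A6
    using assms by (simp add: weq_def field_simps power_numeral_reduce)
  show ?thesis
    unfolding change_vars_def *
    by (simp add: weq_def algebra_simps power_numeral_reduce)
qed

definition isomorphic_curves :: "'a::field weierstrass \<Rightarrow> 'a weierstrass \<Rightarrow> bool" where
  "isomorphic_curves E E' \<longleftrightarrow> (\<exists>u r s t. u \<noteq> 0 \<and> E' = change_vars u r s t E)"

text \<open>The curve \<open>y\<^sup>2 = h(x)\<close> for a cubic \<open>h\<close>, not necessarily monic, brought into Weierstrass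
  form by the coordinate change \<open>(x, y) \<mapsto> (l x, l y)\<close>, where \<open>l\<close> is the leading coefficient.\<close>

definition cubic_curve :: "'a::field poly \<Rightarrow> 'a weierstrass" where
  "cubic_curve h = Weierstrass 0 (Polynomial.coeff h 2) 0
     (Polynomial.coeff h 3 * Polynomial.coeff h 1) (Polynomial.coeff h 3 ^ 2 * Polynomial.coeff h 0)"

lemma weq_cubic_curve:
  assumes "Polynomial.degree h = 3"
  shows "weq (cubic_curve h) (Polynomial.coeff h 3 * x) (Polynomial.coeff h 3 * y)
           = Polynomial.coeff h 3 ^ 2 * (y^2 - poly h x)"
  using assms
  by (simp add: weq_def cubic_curve_def poly_altdef eval_nat_numeral algebra_simps)

text \<open>For a cubic \<open>g\<close>, this is the polynomial \<open>x\<^sup>3 g(1/x + a)\<close>. Its coefficient at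
  \<open>x\<^sup>3\<close> is \<open>g(a)\<close>.\<close>

definition recentre :: "'a::field poly \<Rightarrow> 'a \<Rightarrow> 'a poly" where
  "recentre g a = reflect_poly (pcompose g [:a, 1:])"

lemma poly_recentre:
  assumes "Polynomial.degree g = 3" "x \<noteq> 0"
  shows "poly (recentre g a) x = x^3 * poly g (1 / x + a)"
  using assms
  by (simp add: recentre_def poly_reflect_poly_nz poly_pcompose degree_pcompose
        inverse_eq_divide add.commute)

text \<open>If \<open>g(a) = 0\<close>, then \<open>y\<^sup>2 = c x\<^sup>3 g(1/x + a)\<close> has a right-hand side of degree 2 and
  defines a curve of genus 0, to which no elliptic curve is isomorphic. As
  \<^const>\<open>cubic_curve\<close> is only meaningful for cubics, this case is excluded explicitly.\<close>

definition compatible :: "'a::field weierstrass \<Rightarrow> 'a poly \<Rightarrow> bool" where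
  "compatible E g \<longleftrightarrow>
     (\<exists>c. c \<noteq> 0 \<and> isomorphic_curves E (cubic_curve (smult c g))) \<or>
     (\<exists>a c. c \<noteq> 0 \<and> poly g a \<noteq> 0 \<and> isomorphic_curves E (cubic_curve (smult c (recentre g a))))"

definition compatible_j_invariants :: "'a::field poly \<Rightarrow> 'a set" where
  "compatible_j_invariants g = {j_invariant E | E. elliptic_curve E \<and> compatible E g}"

fun curve_at :: "'a::field poly \<Rightarrow> 'a proj_line \<Rightarrow> 'a weierstrass" where
  "curve_at g (Pt a) = cubic_curve (recentre g a)"
| "curve_at g Infty = cubic_curve g"

end

(* View f1 as a binary cubic form F with discriminant D and Hessian covariant H. The curve attached
   to a point P of the projective line is the double cover branched over P and the roots of f1, and
   j = 256 H(P)^3 / (D F(P)^2), so j is invariant under the stabilizer G of the roots in PGL2(k).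
   If j(P) is neither 0 nor 1728, moving P to infinity and its polar point with respect to H to 0
   brings F to the form x^3 + x^2 y + 9 c x y^2 + c y^3, where c = 64 / (1728 - j), and no
   nontrivial affine map preserves the roots of this form. Hence G acts simply transitively on the
   fibre of j through P. For j = 1728, comparing discriminants shows that G is still transitive on
   the fibre. The fibre over j = 0 is the zero set of H, which has at most two points; when it has
   two, F is equivalent to a x^3 + d y^3, and then G is nontrivial. So every fibre has at most #G
   points, with equality away from 0 and 1728, and removing the roots of f2 affects at most three
   further fibres. *)

theory Submission
  imports Defs
begin

subsection \<open>Binary cubic forms\<close>

datatype 'a cubic_form = Cubic_Form 'a 'a 'a 'a
datatype 'a mat2 = Mat2 'a 'a 'a 'a

fun form_eval :: "'a::field cubic_form \<Rightarrow> 'a \<Rightarrow> 'a \<Rightarrow> 'a" where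
  "form_eval (Cubic_Form a b c d) x y = a * x^3 + b * x^2 * y + c * x * y^2 + d * y^3"

fun form_scale :: "'a::field \<Rightarrow> 'a cubic_form \<Rightarrow> 'a cubic_form" where
  "form_scale l (Cubic_Form a b c d) = Cubic_Form (l * a) (l * b) (l * c) (l * d)"

fun form_disc :: "'a::field cubic_form \<Rightarrow> 'a" where
  "form_disc (Cubic_Form a b c d) =
     b^2 * c^2 - 4 * a * c^3 - 4 * b^3 * d - 27 * a^2 * d^2 + 18 * a * b * c * d"

text \<open>The determinant of the second partial derivatives of the form is \<open>-4\<close> times
  this quadratic form. Dropping the factor keeps it meaningful in every characteristic.\<close>

fun hessian :: "'a::field cubic_form \<Rightarrow> 'a \<Rightarrow> 'a \<Rightarrow> 'a" where
  "hessian (Cubic_Form a b c d) x y =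
     (b^2 - 3 * a * c) * x^2 + (b * c - 9 * a * d) * x * y + (c^2 - 3 * b * d) * y^2"

fun mat2_det :: "'a::field mat2 \<Rightarrow> 'a" where
  "mat2_det (Mat2 p q r s) = p * s - q * r"

fun mat2_mult :: "'a::field mat2 \<Rightarrow> 'a mat2 \<Rightarrow> 'a mat2" where
  "mat2_mult (Mat2 p q r s) (Mat2 p' q' r' s') =
     Mat2 (p * p' + q * r') (p * q' + q * s') (r * p' + s * r') (r * q' + s * s')"

text \<open>Stands in for the inverse: for nonzero determinant the two differ by a scalar, which
  acts trivially on the projective line, and no division enters.\<close>

fun mat2_adj :: "'a::field mat2 \<Rightarrow> 'a mat2" where
  "mat2_adj (Mat2 p q r s) = Mat2 s (- q) (- r) p"

fun mat2_smult :: "'a::field \<Rightarrow> 'a mat2 \<Rightarrow> 'a mat2" where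
  "mat2_smult l (Mat2 p q r s) = Mat2 (l * p) (l * q) (l * r) (l * s)"

text \<open>The coefficients after substituting \<open>p x + q y\<close> for \<open>x\<close> and
  \<open>r x + s y\<close> for \<open>y\<close>. Substitutions compose to a right action of
  matrices.\<close>

fun form_act :: "'a::field cubic_form \<Rightarrow> 'a mat2 \<Rightarrow> 'a cubic_form" where
  "form_act (Cubic_Form a b c d) (Mat2 p q r s) = Cubic_Form
     (a * p^3 + b * p^2 * r + c * p * r^2 + d * r^3)
     (3 * a * p^2 * q + b * (p^2 * s + 2 * p * q * r) + c * (2 * p * r * s + q * r^2) + 3 * d * r^2 * s)
     (3 * a * p * q^2 + b * (2 * p * q * s + q^2 * r) + c * (p * s^2 + 2 * q * r * s) + 3 * d * r * s^2)
     (a * q^3 + b * q^2 * s + c * q * s^2 + d * s^3)"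

lemma mat2_mult_assoc: "mat2_mult (mat2_mult L M) N = mat2_mult L (mat2_mult M N)"
  by (cases L; cases M; cases N) (simp add: algebra_simps)

lemma mat2_det_mult: "mat2_det (mat2_mult M N) = mat2_det M * mat2_det N"
  by (cases M; cases N) (simp add: algebra_simps)

lemma mat2_det_adj: "mat2_det (mat2_adj M) = mat2_det M"
  by (cases M) simp

lemma mat2_mult_adj:
  "mat2_mult M (mat2_adj M) = mat2_smult (mat2_det M) (Mat2 1 0 0 1)"
  "mat2_mult (mat2_adj M) M = mat2_smult (mat2_det M) (Mat2 1 0 0 1)"
  by (cases M; simp add: algebra_simps)+

lemma mat2_smult_mult:
  "mat2_mult (mat2_smult l M) N = mat2_smult l (mat2_mult M N)"
  "mat2_mult M (mat2_smult l N) = mat2_smult l (mat2_mult M N)"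
  by (cases M; cases N; simp add: algebra_simps)+

lemma mat2_smult_smult: "mat2_smult l (mat2_smult m M) = mat2_smult (l * m) M"
  by (cases M) (simp add: mult.assoc)

lemma mat2_mult_one: "mat2_mult M (Mat2 1 0 0 1) = M" "mat2_mult (Mat2 1 0 0 1) M = M"
  by (cases M; simp)+

lemma mat2_smult_one: "mat2_smult 1 M = M"
  by (cases M) simp

lemma mat2_smult_cancel:
  assumes "mat2_smult l M = mat2_smult m N" "l \<noteq> 0"
  shows "M = mat2_smult (m / l) N"
proof -
  have "mat2_smult (1 / l) (mat2_smult l M) = mat2_smult (1 / l) (mat2_smult m N)"
    using assms(1) by simp
  then show ?thesis using assms(2) by (simp add: mat2_smult_smult mat2_smult_one)
qed

lemma mat2_adj_adj: "mat2_adj (mat2_adj M) = M"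
  by (cases M) simp

lemma form_eval_act:
  "form_eval (form_act F (Mat2 p q r s)) x y = form_eval F (p * x + q * y) (r * x + s * y)"
  by (induct F) (simp, Groebner_Basis.algebra)

lemma form_act_mult: "form_act (form_act F M) N = form_act F (mat2_mult M N)"
  by (induct F; induct M; induct N; simp; intro conjI; Groebner_Basis.algebra)

lemma form_act_smult: "form_act F (mat2_smult l M) = form_scale (l^3) (form_act F M)"
  by (induct F; induct M; simp; intro conjI; Groebner_Basis.algebra)

lemma form_act_scale: "form_act (form_scale l F) M = form_scale l (form_act F M)"
  by (induct F; induct M; simp; intro conjI; Groebner_Basis.algebra)

lemma form_act_one: "form_act F (Mat2 1 0 0 1) = F"
  by (cases F) simp

lemma form_scale_scale: "form_scale l (form_scale m F) = form_scale (l * m) F"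
  by (cases F) (simp add: mult.assoc)

lemma form_scale_one: "form_scale 1 F = F"
  by (cases F) simp

lemma form_eval_scale: "form_eval (form_scale l F) x y = l * form_eval F x y"
  by (induct F) (simp add: algebra_simps)

lemma form_eval_homogeneous: "form_eval F (k * x) (k * y) = k^3 * form_eval F x y"
  by (induct F) (simp, Groebner_Basis.algebra)

lemma hessian_homogeneous: "hessian F (k * x) (k * y) = k^2 * hessian F x y"
  by (induct F) (simp, Groebner_Basis.algebra)

lemma form_scale_cancel:
  assumes "form_scale l F = form_scale m G" "l \<noteq> 0"
  shows "F = form_scale (m / l) G"
proof -
  have "form_scale (1 / l) (form_scale l F) = form_scale (1 / l) (form_scale m G)"
    using assms(1) by simp
  then show ?thesis using assms(2) by (simp add: form_scale_scale form_scale_one)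
qed

lemma form_act_adj:
  assumes "form_act F M = form_scale l G"
  shows "form_scale l (form_act G (mat2_adj M)) = form_scale (mat2_det M ^ 3) F"
  using form_act_mult[of F M "mat2_adj M"]
  by (simp only: assms form_act_scale mat2_mult_adj form_act_smult form_act_one)

section \<open>Covariance of the discriminant and the Hessian\<close>

lemma form_disc_act: "form_disc (form_act F M) = mat2_det M ^ 6 * form_disc F"
  by (induct F; induct M) (simp, Groebner_Basis.algebra)

lemma form_disc_scale: "form_disc (form_scale l F) = l^4 * form_disc F"
  by (induct F) (simp, Groebner_Basis.algebra)

lemma hessian_act:
  "hessian (form_act F (Mat2 p q r s)) x y
     = (p * s - q * r)^2 * hessian F (p * x + q * y) (r * x + s * y)"
  by (induct F) (simp, Groebner_Basis.algebra)

lemma hessian_scale: "hessian (form_scale l F) x y = l^2 * hessian F x y"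
  by (induct F) (simp, Groebner_Basis.algebra)

subsection \<open>The j-invariant as a covariant\<close>

definition cubic_form_of :: "'a::field poly \<Rightarrow> 'a cubic_form" where
  "cubic_form_of g = Cubic_Form (Polynomial.coeff g 3) (Polynomial.coeff g 2)
     (Polynomial.coeff g 1) (Polynomial.coeff g 0)"

text \<open>Together with \<open>proj_y\<close> this fixes a representative in homogeneous
  coordinates, so that identities between forms cover \<open>Infty\<close> without a separate
  case.\<close>

fun proj_x :: "'a::field proj_line \<Rightarrow> 'a" where
  "proj_x (Pt x) = x" | "proj_x Infty = 1"

fun proj_y :: "'a::field proj_line \<Rightarrow> 'a" where
  "proj_y (Pt x) = 1" | "proj_y Infty = 0"

text \<open>Numerator and denominator have degree 6 both in the coordinates of the point and in the
  coefficients of the form, so a nonzero rescaling of either leaves the quotient unchanged.\<close>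

definition form_j :: "'a::field cubic_form \<Rightarrow> 'a proj_line \<Rightarrow> 'a" where
  "form_j F P = 256 * hessian F (proj_x P) (proj_y P) ^ 3 /
     (form_disc F * form_eval F (proj_x P) (proj_y P) ^ 2)"

lemma cubic_poly_eq:
  assumes "Polynomial.degree g = 3"
  obtains a b c d where "g = [:d, c, b, a:]" "a \<noteq> 0"
proof -
  define h where "h = [:Polynomial.coeff g 0, Polynomial.coeff g 1, Polynomial.coeff g 2, Polynomial.coeff g 3:]"
  have "g = h"
  proof (rule poly_eqI)
    fix n :: nat
    consider "n = 0" | "n = 1" | "n = 2" | "n = 3" | "n > 3" by linarith
    then show "Polynomial.coeff g n = Polynomial.coeff h n"
    proof cases
      case 5
      then have "Polynomial.coeff h n = 0"
        by (auto simp: h_def coeff_pCons split: nat.split)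
      then show ?thesis using 5 assms by (simp add: Polynomial.coeff_eq_0)
    qed (simp_all add: h_def eval_nat_numeral)
  qed
  moreover have "Polynomial.coeff g 3 \<noteq> 0"
    using assms by (metis leading_coeff_0_iff degree_0 zero_neq_numeral)
  ultimately show ?thesis using that h_def by metis
qed

lemma cubic_form_of_pCons [simp]: "cubic_form_of [:d, c, b, a:] = Cubic_Form a b c d"
  by (simp add: cubic_form_of_def eval_nat_numeral)

lemma poly_eq_form_eval:
  assumes "Polynomial.degree g = 3"
  shows "poly g x = form_eval (cubic_form_of g) x 1"
proof -
  obtain a b c d where g: "g = [:d, c, b, a:]"
    using cubic_poly_eq[OF assms] by metis
  show ?thesis
    unfolding g by (simp, Groebner_Basis.algebra)
qed

text \<open>The map \<open>x -> 1/x + t\<close> has matrix \<open>Mat2 t 1 1 0\<close> and sends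
  infinity to \<open>t\<close>. Recentring therefore moves the finite point \<open>t\<close> to
  infinity, where the invariants of the curve are read off from the coefficients.\<close>

lemma cubic_form_of_recentre:
  assumes "Polynomial.degree g = 3"
  shows "cubic_form_of (recentre g t) = form_act (cubic_form_of g) (Mat2 t 1 1 0)"
proof -
  obtain a b c d where g: "g = [:d, c, b, a:]" "a \<noteq> 0"
    using cubic_poly_eq[OF assms] by metis
  have "pcompose g [:t, 1:] =
      [:a * t^3 + b * t^2 + c * t + d, 3 * a * t^2 + 2 * b * t + c, 3 * a * t + b, a:]"
    unfolding g(1) by (simp add: pcompose_pCons algebra_simps power_numeral_reduce)
  \<comment> \<open>Since the top coefficient \<open>a\<close> is nonzero, the reversal takes place
    at degree 3 even when low coefficients vanish.\<close>
  moreover have "reflect_poly [:d', c', b', a:] = [:a, b', c', d':]" for b' c' d'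
  proof (rule poly_eqI)
    fix n :: nat
    consider "n = 0" | "n = 1" | "n = 2" | "n = 3" | "n > 3" by linarith
    then show "Polynomial.coeff (reflect_poly [:d', c', b', a:]) n = Polynomial.coeff [:a, b', c', d':] n"
      using g(2) by cases (auto simp: coeff_reflect_poly eval_nat_numeral coeff_pCons split: nat.split)
  qed
  ultimately show ?thesis
    by (simp add: g(1) recentre_def algebra_simps)
qed

lemma wdisc_cubic_curve:
  "wdisc (cubic_curve g) = 16 * Polynomial.coeff g 3 ^ 2 * form_disc (cubic_form_of g)"
  by (simp add: wdisc_def wb2_def wb4_def wb6_def wb8_def cubic_curve_def cubic_form_of_def,
      Groebner_Basis.algebra)

lemma wc4_cubic_curve: "wc4 (cubic_curve g) = 16 * hessian (cubic_form_of g) 1 0"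
  by (simp add: wc4_def wb2_def wb4_def cubic_curve_def cubic_form_of_def algebra_simps power2_eq_square)

lemma wdisc_curve_at:
  assumes "Polynomial.degree g = 3"
  shows "wdisc (curve_at g P) =
    16 * form_eval (cubic_form_of g) (proj_x P) (proj_y P) ^ 2 * form_disc (cubic_form_of g)"
proof -
  obtain a b c d where g: "g = [:d, c, b, a:]" "a \<noteq> 0"
    using cubic_poly_eq[OF assms] by metis
  show ?thesis
  proof (cases P)
    case (Pt t)
    have "Polynomial.coeff h 3 = form_eval (cubic_form_of h) 1 0" for h :: "'a poly"
      by (simp add: cubic_form_of_def)
    with Pt show ?thesis
      by (simp only: curve_at.simps wdisc_cubic_curve cubic_form_of_recentre[OF assms]
          form_eval_act form_disc_act) simp
  next
    case Infty
    then show ?thesis by (simp only: curve_at.simps wdisc_cubic_curve) (simp add: g eval_nat_numeral)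
  qed
qed

lemma wc4_curve_at:
  assumes "Polynomial.degree g = 3"
  shows "wc4 (curve_at g P) = 16 * hessian (cubic_form_of g) (proj_x P) (proj_y P)"
  by (cases P) (simp_all add: wc4_cubic_curve cubic_form_of_recentre[OF assms] hessian_act)

lemma j_invariant_curve_at:
  assumes "Polynomial.degree (g :: 'a::field poly) = 3" "(2::'a) \<noteq> 0"
  shows "j_invariant (curve_at g P) = form_j (cubic_form_of g) P"
proof -
  have "(16::'a) = 2 ^ 4" by simp
  with assms(2) have "(16::'a) \<noteq> 0" by (metis power_not_zero)
  have "(16 * h) ^ 3 / (16 * e ^ 2 * D) = 256 * h ^ 3 / (D * e ^ 2)" for h e D :: 'a
  proof -
    have "(16 * h) ^ 3 / (16 * e ^ 2 * D) = (16 * (256 * h ^ 3)) / (16 * (D * e ^ 2))"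
      by (simp add: power_mult_distrib mult_ac)
    also have "\<dots> = 256 * h ^ 3 / (D * e ^ 2)"
      using \<open>(16::'a) \<noteq> 0\<close> by (rule mult_divide_mult_cancel_left)
    finally show ?thesis .
  qed
  then show ?thesis
    unfolding j_invariant_def wc4_curve_at[OF assms(1)] wdisc_curve_at[OF assms(1)] form_j_def .
qed

section \<open>Invariance of j under isomorphism and quadratic twist\<close>

lemma wc4_change_vars:
  assumes "u \<noteq> 0"
  shows "u^4 * wc4 (change_vars u r s t E) = wc4 E"
proof -
  \<comment> \<open>The scaling by \<open>u\<close> is separated from the substitution in
    \<open>r\<close>, \<open>s\<close>, \<open>t\<close>, so that what remains is a polynomial
    identity without denominators.\<close>
  have *: "u^4 * wc4 (Weierstrass (A1 / u) (A2 / u^2) (A3 / u^3) (A4 / u^4) (A6 / u^6)) =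
     wc4 (Weierstrass A1 A2 A3 A4 A6)" for A1 A2 A3 A4 A6
    using assms by (simp add: wc4_def wb2_def wb4_def field_simps power_numeral_reduce)
  show ?thesis
    unfolding change_vars_def *
    by (simp add: wc4_def wb2_def wb4_def, Groebner_Basis.algebra)
qed

lemma wdisc_change_vars:
  assumes "u \<noteq> 0"
  shows "u^12 * wdisc (change_vars u r s t E) = wdisc E"
proof -
  have *: "u^12 * wdisc (Weierstrass (A1 / u) (A2 / u^2) (A3 / u^3) (A4 / u^4) (A6 / u^6)) =
     wdisc (Weierstrass A1 A2 A3 A4 A6)" (is "_ * wdisc ?W = wdisc ?V") for A1 A2 A3 A4 A6
  proof -
    \<comment> \<open>The b-invariants have weights 2, 4, 6 and 8. Rescaling them first leaves only
      a short identity in four variables for the discriminant.\<close>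
    have b2: "wb2 ?W = wb2 ?V / u^2" and b4: "wb4 ?W = wb4 ?V / u^4"
      and b6: "wb6 ?W = wb6 ?V / u^6" and b8: "wb8 ?W = wb8 ?V / u^8"
      using assms by (simp_all add: wb2_def wb4_def wb6_def wb8_def field_simps power_numeral_reduce)
    have "u^12 * (- ((p / u^2) ^ 2 * (z / u^8)) - 8 * (q / u^4) ^ 3 - 27 * (w / u^6) ^ 2
        + 9 * (p / u^2) * (q / u^4) * (w / u^6))
        = - (p ^ 2 * z) - 8 * q ^ 3 - 27 * w ^ 2 + 9 * p * q * w" for p q w z
      using assms by (simp add: field_simps power_numeral_reduce)
    then show ?thesis
      unfolding wdisc_def b2 b4 b6 b8 .
  qed
  show ?thesis
    unfolding change_vars_def *
    by (simp add: wdisc_def wb2_def wb4_def wb6_def wb8_def, Groebner_Basis.algebra)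
qed

lemma j_invariant_isomorphic:
  assumes "isomorphic_curves E E'"
  shows "j_invariant E' = j_invariant E"
proof -
  obtain u r s t where u: "u \<noteq> 0" and E': "E' = change_vars u r s t E"
    using assms unfolding isomorphic_curves_def by blast
  have "j_invariant E = (u^4 * wc4 E') ^ 3 / (u^12 * wdisc E')"
    unfolding j_invariant_def E' wc4_change_vars[OF u] wdisc_change_vars[OF u] ..
  also have "\<dots> = j_invariant E'"
    using u by (simp add: j_invariant_def power_mult_distrib flip: power_mult)
  finally show ?thesis by simp
qed

lemma isomorphic_curves_refl: "isomorphic_curves E E"
  unfolding isomorphic_curves_def
  by (rule exI[of _ 1], rule exI[of _ 0], rule exI[of _ 0], rule exI[of _ 0])
    (cases E, simp add: change_vars_def)

text \<open>Multiplying the cubic by \<open>c\<close> is a quadratic twist, in general not an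
  isomorphism over the field. It scales \<open>c4\<close> by \<open>c^2\<close> and the discriminant
  by \<open>c^6\<close>, and these factors cancel in j.\<close>

lemma j_invariant_cubic_curve_smult:
  assumes "c \<noteq> 0"
  shows "j_invariant (cubic_curve (smult c g)) = j_invariant (cubic_curve g)"
proof -
  have form: "cubic_form_of (smult c g) = form_scale c (cubic_form_of g)"
    by (simp add: cubic_form_of_def)
  have "j_invariant (cubic_curve (smult c g)) =
      (c^2 * wc4 (cubic_curve g)) ^ 3 / (c^6 * wdisc (cubic_curve g))"
    unfolding j_invariant_def wc4_cubic_curve wdisc_cubic_curve form hessian_scale form_disc_scale
    by (simp add: power_mult_distrib eval_nat_numeral mult_ac)
  also have "\<dots> = j_invariant (cubic_curve g)"
    using assms by (simp add: j_invariant_def power_mult_distrib flip: power_mult)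
  finally show ?thesis .
qed

subsection \<open>The action on the projective line\<close>

fun mat2_moebius :: "'a::field mat2 \<Rightarrow> 'a proj_line \<Rightarrow> 'a proj_line" where
  "mat2_moebius (Mat2 p q r s) = moebius p q r s"

lemma proj_line_eqI:
  assumes "proj_x P = k * proj_x Q" "proj_y P = k * proj_y Q" "k \<noteq> 0"
  shows "P = Q"
  using assms by (cases P; cases Q) auto

text \<open>Trades the case distinctions in \<open>moebius\<close> for linear algebra: the matrix
  acts on coordinate vectors, and \<open>k\<close> accounts for the normalised representative of the
  image.\<close>

lemma moebius_eq_iff:
  assumes "p * s - q * r \<noteq> 0"
  shows "moebius p q r s P = Q \<longleftrightarrow> (\<exists>k. k \<noteq> 0 \<and>
    p * proj_x P + q * proj_y P = k * proj_x Q \<and> r * proj_x P + s * proj_y P = k * proj_y Q)"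
proof -
  have ex: "\<exists>k. k \<noteq> 0 \<and> p * proj_x P + q * proj_y P = k * proj_x (moebius p q r s P) \<and>
    r * proj_x P + s * proj_y P = k * proj_y (moebius p q r s P)"
  proof (cases P)
    case (Pt x)
    show ?thesis
    proof (cases "r * x + s = 0")
      case True
      \<comment> \<open>Otherwise the matrix would kill the nonzero vector
        \<open>(x, 1)\<close>.\<close>
      have "p * x + q \<noteq> 0"
      proof
        assume "p * x + q = 0"
        with True have "p * s - q * r = 0" "(p * s - q * r) * x = 0"
          by Groebner_Basis.algebra+
        then show False using assms by simp
      qed
      then show ?thesis using True Pt by auto
    next
      case False
      then show ?thesis using Pt by (intro exI[of _ "r * x + s"]) simp
    qed
  next
    case Infty
    show ?thesis
    proof (cases "r = 0")
      case True
      then show ?thesis using Infty assms by auto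
    next
      case False
      then show ?thesis using Infty by (intro exI[of _ r]) simp
    qed
  qed
  show ?thesis
  proof
    assume "moebius p q r s P = Q"
    then show "\<exists>k. k \<noteq> 0 \<and>
      p * proj_x P + q * proj_y P = k * proj_x Q \<and> r * proj_x P + s * proj_y P = k * proj_y Q"
      using ex by auto
  next
    assume "\<exists>k. k \<noteq> 0 \<and>
      p * proj_x P + q * proj_y P = k * proj_x Q \<and> r * proj_x P + s * proj_y P = k * proj_y Q"
    then obtain k where k: "k \<noteq> 0" "p * proj_x P + q * proj_y P = k * proj_x Q"
      "r * proj_x P + s * proj_y P = k * proj_y Q" by blast
    obtain l where l: "l \<noteq> 0" "p * proj_x P + q * proj_y P = l * proj_x (moebius p q r s P)"
      "r * proj_x P + s * proj_y P = l * proj_y (moebius p q r s P)"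
      using ex by blast
    show "moebius p q r s P = Q"
    proof (rule proj_line_eqI)
      show "proj_x (moebius p q r s P) = k / l * proj_x Q"
        "proj_y (moebius p q r s P) = k / l * proj_y Q"
        using k l by (simp_all add: field_simps)
      show "k / l \<noteq> 0" using k l by simp
    qed
  qed
qed

lemma mat2_moebius_mult:
  assumes "mat2_det M \<noteq> 0" "mat2_det N \<noteq> 0"
  shows "mat2_moebius (mat2_mult M N) P = mat2_moebius M (mat2_moebius N P)"
proof -
  obtain p q r s p' q' r' s' where M: "M = Mat2 p q r s" and N: "N = Mat2 p' q' r' s'"
    by (metis mat2.exhaust)
  have dM: "p * s - q * r \<noteq> 0" and dN: "p' * s' - q' * r' \<noteq> 0"
    using assms by (simp_all add: M N)
  have dMN: "(p * p' + q * r') * (r * q' + s * s') - (p * q' + q * s') * (r * p' + s * r') \<noteq> 0"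
    using assms mat2_det_mult[of M N] by (simp add: M N)
  let ?R = "mat2_moebius N P" and ?Q = "mat2_moebius M (mat2_moebius N P)"
  obtain k where k: "k \<noteq> 0" "p' * proj_x P + q' * proj_y P = k * proj_x ?R"
    "r' * proj_x P + s' * proj_y P = k * proj_y ?R"
    using moebius_eq_iff[OF dN, of P ?R] by (auto simp: N)
  obtain l where l: "l \<noteq> 0" "p * proj_x ?R + q * proj_y ?R = l * proj_x ?Q"
    "r * proj_x ?R + s * proj_y ?R = l * proj_y ?Q"
    using moebius_eq_iff[OF dM, of ?R ?Q] by (auto simp: M)
  have "(p * p' + q * r') * proj_x P + (p * q' + q * s') * proj_y P
      = p * (p' * proj_x P + q' * proj_y P) + q * (r' * proj_x P + s' * proj_y P)"
    by (simp add: algebra_simps)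
  also have "\<dots> = k * (p * proj_x ?R + q * proj_y ?R)"
    unfolding k by (simp add: algebra_simps)
  finally have 1: "(p * p' + q * r') * proj_x P + (p * q' + q * s') * proj_y P = k * l * proj_x ?Q"
    unfolding l by simp
  have "(r * p' + s * r') * proj_x P + (r * q' + s * s') * proj_y P
      = r * (p' * proj_x P + q' * proj_y P) + s * (r' * proj_x P + s' * proj_y P)"
    by (simp add: algebra_simps)
  also have "\<dots> = k * (r * proj_x ?R + s * proj_y ?R)"
    unfolding k by (simp add: algebra_simps)
  finally have 2: "(r * p' + s * r') * proj_x P + (r * q' + s * s') * proj_y P = k * l * proj_y ?Q"
    unfolding l by simp
  have "moebius (p * p' + q * r') (p * q' + q * s') (r * p' + s * r') (r * q' + s * s') P = ?Q"
    using 1 2 k(1) l(1) by (subst moebius_eq_iff[OF dMN], intro exI[of _ "k * l"]) simp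
  then show ?thesis by (simp add: M N)
qed

lemma mat2_moebius_smult:
  assumes "l \<noteq> 0"
  shows "mat2_moebius (mat2_smult l M) = mat2_moebius M"
proof
  fix P
  obtain p q r s where M: "M = Mat2 p q r s" by (cases M)
  have *: "l * p * x + l * q = l * (p * x + q)" for x p q
    by (simp add: algebra_simps)
  show "mat2_moebius (mat2_smult l M) P = mat2_moebius M P"
    using assms by (cases P) (simp_all add: M *)
qed

lemma mat2_moebius_one: "mat2_moebius (Mat2 1 0 0 1) P = P"
  by (cases P) simp_all

text \<open>Numerator and denominator acquire the same factor: the sixth power of the determinant,
  by covariance, times \<open>k^6\<close>, from normalising the image point.\<close>

lemma form_j_act:
  assumes "mat2_det M \<noteq> 0"
  shows "form_j (form_act F M) P = form_j F (mat2_moebius M P)"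
proof -
  obtain p q r s where M: "M = Mat2 p q r s" by (cases M)
  have d: "p * s - q * r \<noteq> 0" using assms by (simp add: M)
  let ?Q = "moebius p q r s P"
  obtain k where k: "k \<noteq> 0" "p * proj_x P + q * proj_y P = k * proj_x ?Q"
    "r * proj_x P + s * proj_y P = k * proj_y ?Q"
    using moebius_eq_iff[OF d, of P ?Q] by auto
  have "256 * (D^2 * (k^2 * H)) ^ 3 / (D ^ 6 * E * (k^3 * V) ^ 2) = 256 * H^3 / (E * V^2)"
    if "D \<noteq> 0" for D H E V :: 'a
  proof -
    have "256 * (D^2 * (k^2 * H)) ^ 3 / (D ^ 6 * E * (k^3 * V) ^ 2)
        = ((D^6 * k^6) * (256 * H^3)) / ((D^6 * k^6) * (E * V^2))"
      by (simp add: power_mult_distrib mult_ac flip: power_mult)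
    also have "\<dots> = 256 * H^3 / (E * V^2)"
      using that k(1) by (intro mult_divide_mult_cancel_left) simp
    finally show ?thesis .
  qed
  then show ?thesis using d
    by (simp add: form_j_def M hessian_act form_disc_act form_eval_act k
      form_eval_homogeneous hessian_homogeneous)
qed

lemma form_j_scale:
  assumes "l \<noteq> 0"
  shows "form_j (form_scale l F) P = form_j F P"
proof -
  have "256 * (l^2 * H) ^ 3 / (l ^ 4 * E * (l * V) ^ 2) = 256 * H^3 / (E * V^2)" for H E V :: 'a
  proof -
    have "256 * (l^2 * H) ^ 3 / (l ^ 4 * E * (l * V) ^ 2)
        = ((l^6) * (256 * H^3)) / ((l^6) * (E * V^2))"
      by (simp add: power_mult_distrib eval_nat_numeral mult_ac)
    also have "\<dots> = 256 * H^3 / (E * V^2)"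
      using assms by (intro mult_divide_mult_cancel_left) simp
    finally show ?thesis .
  qed
  then show ?thesis
    by (simp add: form_j_def hessian_scale form_disc_scale form_eval_scale)
qed

section \<open>Symmetries of a cubic form up to a scalar\<close>

text \<open>A set of matrices closed under nonzero scaling. When the form comes from a separable
  cubic, its classes modulo scalars are the automorphisms that permute the roots, see
  \<open>num_root_auts_eq\<close>.\<close>

definition form_stabilizer :: "'a::field cubic_form \<Rightarrow> 'a mat2 set" where
  "form_stabilizer F = {M. mat2_det M \<noteq> 0 \<and> (\<exists>l. form_act F M = form_scale l F)}"

lemma form_stabilizerI:
  assumes "mat2_det M \<noteq> 0" "form_act F M = form_scale l F"
  shows "M \<in> form_stabilizer F"
  using assms by (auto simp: form_stabilizer_def)

text \<open>Computing the discriminant of the transformed form in two ways expresses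
  \<open>l^4\<close> through the determinant of \<open>M\<close>.\<close>

lemma form_stabilizer_scale_nonzero:
  assumes "form_disc F \<noteq> 0" "mat2_det M \<noteq> 0" "form_act F M = form_scale l F"
  shows "l \<noteq> 0"
proof -
  have "mat2_det M ^ 6 * form_disc F = l^4 * form_disc F"
    using form_disc_act[of F M] form_disc_scale[of l F] assms(3) by metis
  then show ?thesis using assms by auto
qed

lemma form_eval_moebius_eq_0_iff:
  assumes "mat2_det M \<noteq> 0"
  shows "form_eval F (proj_x (mat2_moebius M P)) (proj_y (mat2_moebius M P)) = 0
     \<longleftrightarrow> form_eval (form_act F M) (proj_x P) (proj_y P) = 0"
proof -
  obtain p q r s where M: "M = Mat2 p q r s" by (cases M)
  have d: "p * s - q * r \<noteq> 0" using assms by (simp add: M)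
  let ?Q = "moebius p q r s P"
  obtain k where k: "k \<noteq> 0" "p * proj_x P + q * proj_y P = k * proj_x ?Q"
    "r * proj_x P + s * proj_y P = k * proj_y ?Q"
    using moebius_eq_iff[OF d, of P ?Q] by auto
  show ?thesis using k(1) by (simp add: M form_eval_act k form_eval_homogeneous)
qed

lemma form_stabilizer_moebius:
  assumes "form_disc F \<noteq> 0" "M \<in> form_stabilizer F"
  shows "form_j F (mat2_moebius M P) = form_j F P"
    and "form_eval F (proj_x (mat2_moebius M P)) (proj_y (mat2_moebius M P)) = 0
      \<longleftrightarrow> form_eval F (proj_x P) (proj_y P) = 0"
proof -
  obtain l where M: "mat2_det M \<noteq> 0" "form_act F M = form_scale l F"
    using assms(2) by (auto simp: form_stabilizer_def)
  have l: "l \<noteq> 0" using form_stabilizer_scale_nonzero[OF assms(1) M] .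
  show "form_j F (mat2_moebius M P) = form_j F P"
    unfolding form_j_act[OF M(1), symmetric] M(2) by (rule form_j_scale[OF l])
  show "form_eval F (proj_x (mat2_moebius M P)) (proj_y (mat2_moebius M P)) = 0
      \<longleftrightarrow> form_eval F (proj_x P) (proj_y P) = 0"
    using form_eval_moebius_eq_0_iff[OF M(1), of F P] l unfolding M(2) by (simp add: form_eval_scale)
qed

subsection \<open>Normal forms and the stabilizer\<close>

text \<open>The coefficient 9 makes the mixed term \<open>b c - 9 a d\<close> of the Hessian vanish.
  For \<open>t = 1728\<close> the coefficient of \<open>x^2 y\<close> is absent, and
  \<open>D\<close> is kept to record the class of the discriminant modulo squares.\<close>

definition canonical_form :: "'a::field \<Rightarrow> 'a \<Rightarrow> 'a cubic_form" where
  "canonical_form D t = (if t = 1728 then Cubic_Form 1 0 (- D) 0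
     else Cubic_Form 1 1 (9 * (64 / (1728 - t))) (64 / (1728 - t)))"

text \<open>Up to the squared determinant, the mixed coefficient of the new Hessian is the polar
  bilinear form of the old one at the columns \<open>(p, r)\<close> and \<open>(q, s)\<close>. In
  contrast to \<open>hessian_act\<close> this speaks of a coefficient, not of values.\<close>

lemma hessian_act_polar:
  assumes "form_act (Cubic_Form f3 f2 f1 f0) (Mat2 p q r s) = Cubic_Form a b c d"
  shows "b * c - 9 * a * d = (p * s - q * r)^2 * (2 * (f2^2 - 3 * f3 * f1) * p * q
    + (f2 * f1 - 9 * f3 * f0) * (p * s + q * r) + 2 * (f1^2 - 3 * f2 * f0) * r * s)"
proof -
  have *: "a = f3 * p^3 + f2 * p^2 * r + f1 * p * r^2 + f0 * r^3"
    "b = 3 * f3 * p^2 * q + f2 * (p^2 * s + 2 * p * q * r) + f1 * (2 * p * r * s + q * r^2) + 3 * f0 * r^2 * s"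
    "c = 3 * f3 * p * q^2 + f2 * (2 * p * q * s + q^2 * r) + f1 * (p * s^2 + 2 * q * r * s) + 3 * f0 * r * s^2"
    "d = f3 * q^3 + f2 * q^2 * s + f1 * q * s^2 + f0 * s^3"
    using assms by simp_all
  show ?thesis
    unfolding * by Groebner_Basis.algebra
qed

text \<open>The normal form depends on \<open>P\<close> only through j. Two points with the same
  nonzero j can therefore be compared by passing through it.\<close>

lemma canonical_form_exists:
  fixes F :: "'a::field cubic_form"
  assumes two: "(2::'a) \<noteq> 0" and disc: "form_disc F \<noteq> 0"
    and nz: "form_eval F (proj_x P) (proj_y P) \<noteq> 0" and j: "form_j F P \<noteq> 0"
  obtains N l where "mat2_det N \<noteq> 0" "l \<noteq> 0" "mat2_moebius N Infty = P"
    "form_act F N = form_scale l (canonical_form (form_disc F) (form_j F P))"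
proof -
  note found = that
  define x y where "x = proj_x P" and "y = proj_y P"
  obtain f3 f2 f1 f0 where F: "F = Cubic_Form f3 f2 f1 f0" by (cases F)
  define A B C where "A = f2^2 - 3 * f3 * f1" and "B = f2 * f1 - 9 * f3 * f0"
    and "C = f1^2 - 3 * f2 * f0"
  have H: "hessian F u v = A * u^2 + B * u * v + C * v^2" for u v
    by (simp add: F A_def B_def C_def)
  \<comment> \<open>\<open>(x', y')\<close> is the polar point of \<open>P\<close> with respect to the Hessian; with it as second basis
    vector the Hessian has no mixed term.\<close>
  define x' y' where "x' = - (B * x + 2 * C * y)" and "y' = 2 * A * x + B * y"
  have H0: "hessian F x y \<noteq> 0"
    using j by (auto simp: form_j_def x_def y_def)
  have det0: "x * y' - x' * y = 2 * hessian F x y"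
    unfolding H x'_def y'_def by (simp add: algebra_simps power2_eq_square)
  define N0 where "N0 = Mat2 x x' y y'"
  have N0: "mat2_det N0 \<noteq> 0" using det0 H0 two by (simp add: N0_def mult.commute)
  have N0_Infty: "mat2_moebius N0 Infty = P"
    using N0 unfolding N0_def mat2_moebius.simps mat2_det.simps
    by (subst moebius_eq_iff) (auto simp: x_def y_def intro!: exI[of _ 1])
  obtain a b c d where G: "form_act F N0 = Cubic_Form a b c d" by (cases "form_act F N0")
  have "form_eval (form_act F N0) (proj_x Infty) (proj_y Infty) \<noteq> 0"
    using form_eval_moebius_eq_0_iff[OF N0, of F Infty] nz N0_Infty by simp
  then have a: "a \<noteq> 0" by (simp add: G)
  have "b * c - 9 * a * d = (x * y' - x' * y)^2 *
     (2 * A * x * x' + B * (x * y' + x' * y) + 2 * C * y * y')"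
    using hessian_act_polar[OF G[unfolded N0_def F]] unfolding A_def B_def C_def .
  also have "2 * A * x * x' + B * (x * y' + x' * y) + 2 * C * y * y' = 0"
    unfolding x'_def y'_def by (simp add: algebra_simps)
  finally have bc: "b * c = 9 * a * d" by simp
  have jG: "form_j (Cubic_Form a b c d) Infty = form_j F P"
    using form_j_act[OF N0, of F Infty] by (simp add: G N0_Infty)
  have discG: "form_disc (Cubic_Form a b c d) = mat2_det N0 ^ 6 * form_disc F"
    using form_disc_act[of F N0] by (simp add: G)
  \<comment> \<open>The remaining freedom is to scale the first coordinate by \<open>s\<close>,
    which fixes infinity and preserves the absence of a mixed Hessian term.\<close>
  have goal: thesis if sl: "s \<noteq> 0" "l \<noteq> 0"
    and eq: "Cubic_Form (a * s^3) (b * s^2) (c * s) d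
       = form_scale l (canonical_form (form_disc F) (form_j F P))" for s l
  proof (rule found[of "mat2_mult N0 (Mat2 s 0 0 1)" l])
    have det: "mat2_det (Mat2 s 0 0 1) \<noteq> 0" using sl by simp
    show "mat2_det (mat2_mult N0 (Mat2 s 0 0 1)) \<noteq> 0"
      unfolding mat2_det_mult using N0 det by simp
    show "l \<noteq> 0" by fact
    show "mat2_moebius (mat2_mult N0 (Mat2 s 0 0 1)) Infty = P"
      unfolding mat2_moebius_mult[OF N0 det] using N0_Infty by simp
    show "form_act F (mat2_mult N0 (Mat2 s 0 0 1))
        = form_scale l (canonical_form (form_disc F) (form_j F P))"
      unfolding form_act_mult[symmetric] G eq[symmetric] by simp
  qed
  have four: "(4::'a) \<noteq> 0"
    using power_not_zero[OF two, of 2] by simp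
  show thesis
  proof (cases "b = 0")
    case False
    \<comment> \<open>Scaling by \<open>s = b / a\<close> makes the first two coefficients equal.
      Their common value is \<open>l\<close>, and \<open>e\<close> is \<open>d / l\<close>.\<close>
    define l e where "l = b^3 / a^2" and "e = d * a^2 / b^3"
    have l: "l \<noteq> 0" using a False by (simp add: l_def)
    have eq: "Cubic_Form (a * (b / a)^3) (b * (b / a)^2) (c * (b / a)) d
        = form_scale l (Cubic_Form 1 1 (9 * e) e)"
      using a False bc by (simp add: l_def e_def field_simps power2_eq_square power3_eq_cube)
    let ?M = "Mat2 (b / a) 0 0 1"
    have act: "form_act (Cubic_Form a b c d) ?M = form_scale l (Cubic_Form 1 1 (9 * e) e)"
      unfolding eq[symmetric] by simp
    have "form_j (Cubic_Form 1 1 (9 * e) e) Infty = form_j (Cubic_Form a b c d) (mat2_moebius ?M Infty)"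
      using form_j_act[of ?M "Cubic_Form a b c d" Infty] a False
      unfolding act form_j_scale[OF l] by simp
    then have je: "form_j (Cubic_Form 1 1 (9 * e) e) Infty = form_j F P"
      using jG by simp
    have dd: "l^4 * form_disc (Cubic_Form 1 1 (9 * e) e) = (b / a)^6 * form_disc (Cubic_Form a b c d)"
      using form_disc_act[of "Cubic_Form a b c d" ?M] unfolding act form_disc_scale by simp
    have de: "form_disc (Cubic_Form 1 1 (9 * e) e) \<noteq> 0"
      using dd discG a False l N0 disc by auto
    have disc_e: "form_disc (Cubic_Form 1 1 (9 * e) e) = - 4 * e * (1 - 27 * e)^2"
      by (simp, Groebner_Basis.algebra)
    have e: "e \<noteq> 0" "1 - 27 * e \<noteq> 0" using de unfolding disc_e by auto
    \<comment> \<open>The Hessian at infinity is \<open>1 - 27 e\<close>, and its square divides the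
      discriminant. Hence j is a linear function of \<open>1 / e\<close> and determines
      \<open>e\<close>.\<close>
    have "form_j F P = 256 * (1 - 27 * e)^3 / (- 4 * e * (1 - 27 * e)^2)"
      unfolding je[symmetric] unfolding form_j_def disc_e by simp
    also have "\<dots> = 1728 - 64 / e"
    proof -
      define w where "w = 1 - 27 * e"
      have "256 * w^3 / (- 4 * e * w^2) = ((4 * w^2) * (64 * w)) / ((4 * w^2) * - e)"
        by (simp add: power2_eq_square power3_eq_cube mult_ac)
      also have "\<dots> = 64 * w / - e"
        using four e(2) by (intro mult_divide_mult_cancel_left) (simp add: w_def)
      also have "\<dots> = 1728 - 64 / e"
        using e(1) by (simp add: w_def field_simps)
      finally show ?thesis by (simp add: w_def)
    qed
    finally have t: "1728 - form_j F P = 64 / e" by simp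
    have "(64::'a) = 2 ^ 6" by simp
    with two have 64: "(64::'a) \<noteq> 0" by (metis power_not_zero)
    have "form_j F P \<noteq> 1728" "64 / (1728 - form_j F P) = e"
      using t 64 e by auto
    then have "canonical_form (form_disc F) (form_j F P) = Cubic_Form 1 1 (9 * e) e"
      by (simp add: canonical_form_def)
    then show thesis
      using goal[of "b / a" l] eq a False l by simp
  next
    case True
    have "hessian (Cubic_Form a b c d) 1 0 \<noteq> 0"
      using j unfolding jG[symmetric] unfolding form_j_def by auto
    \<comment> \<open>In particular 3 is nonzero in this case, so \<open>9 a d = 0\<close> will
      force \<open>d = 0\<close>.\<close>
    then have ac: "3 * (a * c) \<noteq> 0" by (simp add: True)
    have "9 * (a * d) = 3 * (3 * (a * d))" by simp
    then have "3 * (3 * (a * d)) = 0" using bc True by (simp add: mult.assoc)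
    then have d: "d = 0" using ac by (metis mult_eq_0_iff)
    have c: "c \<noteq> 0" using ac by auto
    have disc_d: "form_disc (Cubic_Form a b c d) = - 4 * a * c^3"
      by (simp add: True d)
    have "form_j F P = 256 * (- 3 * a * c)^3 / ((- 4 * a * c^3) * a^2)"
      unfolding jG[symmetric] unfolding form_j_def disc_d by (simp add: True)
    also have "\<dots> = 1728"
    proof -
      have "256 * (- 3 * a * c)^3 / ((- 4 * a * c^3) * a^2)
          = ((4 * a^3 * c^3) * 1728) / ((4 * a^3 * c^3) * 1)"
        by (simp add: power2_eq_square power3_eq_cube mult_ac)
      also have "\<dots> = 1728 / 1"
        using four a c by (intro mult_divide_mult_cancel_left) simp
      finally show ?thesis by simp
    qed
    finally have t: "form_j F P = 1728" .
    \<comment> \<open>Since the discriminant changes by the square of \<open>det N0 ^ 3\<close>, the quotient \<open>c / a\<close> is \<open>- D\<close> up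
      to a square, and \<open>s\<close> is a root of that square.\<close>
    define s where "s = mat2_det N0 ^ 3 / (2 * a * c)"
    have s: "s \<noteq> 0" using N0 a c two by (simp add: s_def)
    have "(2 * a * c * s)^2 = mat2_det N0 ^ 6"
      using a c two by (simp add: s_def power_divide flip: power_mult)
    then have "(2 * a * c * s)^2 * form_disc F = - 4 * a * c^3"
      using discG unfolding disc_d by simp
    then have "(4 * a * c^2) * (a * s^2 * form_disc F + c) = 0"
      by (simp add: power2_eq_square power3_eq_cube algebra_simps)
    then have "a * s^2 * form_disc F + c = 0"
      using four a c by simp
    then have "c = - (a * s^2 * form_disc F)"
      by (simp add: eq_neg_iff_add_eq_0 add.commute)
    then have "c * s = a * s^3 * - form_disc F"
      by (simp add: power2_eq_square power3_eq_cube mult_ac)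
    then have "Cubic_Form (a * s^3) (b * s^2) (c * s) d = form_scale (a * s^3) (Cubic_Form 1 0 (- form_disc F) 0)"
      by (simp add: True d)
    then show thesis
      using goal[of s "a * s^3"] s a by (simp add: canonical_form_def t)
  qed
qed

text \<open>The zero entry says that the map fixes infinity. Comparing the first two coefficients
  gives \<open>p = 3 q + s\<close>, the third then gives \<open>q = 0\<close> or
  \<open>3 q = -2 s\<close>, and the last one excludes a nonzero \<open>q\<close>.\<close>

lemma canonical_form_stabilizer_trivial:
  fixes c :: "'a::field"
  assumes two: "(2::'a) \<noteq> 0" and disc: "form_disc (Cubic_Form 1 1 (9 * c) c) \<noteq> 0"
    and det: "p * s \<noteq> 0"
    and eq: "form_act (Cubic_Form 1 1 (9 * c) c) (Mat2 p q 0 s) = form_scale m (Cubic_Form 1 1 (9 * c) c)"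
  shows "q = 0" "s = p"
proof -
  have four: "(4::'a) \<noteq> 0"
    using power_not_zero[OF two, of 2] by simp
  have disc_c: "form_disc (Cubic_Form 1 1 (9 * c) c) = - 4 * c * (1 - 27 * c)^2"
    by (simp, Groebner_Basis.algebra)
  have c: "c \<noteq> 0" "1 - 27 * c \<noteq> 0" using disc unfolding disc_c by auto
  have m: "m = p^3" and e2: "3 * p^2 * q + p^2 * s = m"
    and e3: "3 * p * q^2 + 2 * p * q * s + 9 * c * (p * s^2) = m * (9 * c)"
    and e4: "q^3 + q^2 * s + 9 * c * (q * s^2) + c * s^3 = m * c"
    using eq by (simp_all add: mult.assoc)
  have ps: "p \<noteq> 0" "s \<noteq> 0" using det by auto
  have "p^2 * (3 * q + s - p) = 0"
    using e2 unfolding m by (simp add: algebra_simps power2_eq_square power3_eq_cube)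
  then have p: "p = 3 * q + s" using ps by (metis eq_iff_diff_eq_0 mult_eq_0_iff power_not_zero)
  have "3 * p * q^2 + 2 * p * q * s + 9 * c * (p * s^2) - p^3 * (9 * c)
      = p * (3 * q^2 + 2 * q * s + 9 * c * (s^2 - p^2))"
    by Groebner_Basis.algebra
  also have "3 * q^2 + 2 * q * s + 9 * c * (s^2 - p^2) = q * ((3 * q + 2 * s) * (1 - 27 * c))"
    unfolding p by Groebner_Basis.algebra
  finally have "p * (q * ((3 * q + 2 * s) * (1 - 27 * c))) = 0"
    using e3 unfolding m by simp
  then have *: "q = 0 \<or> 3 * q + 2 * s = 0" using ps c by (metis mult_eq_0_iff)
  have "q = 0"
  proof (rule ccontr)
    assume "q \<noteq> 0"
    then have q: "3 * q = - 2 * s" using * by (simp add: eq_neg_iff_add_eq_0)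
    then have p': "p = - s" unfolding p by simp
    \<comment> \<open>Multiplying by 27 lets \<open>q\<close> occur only through \<open>3 q\<close>,
      so \<open>-2 s\<close> can be substituted without dividing by 3.\<close>
    have "27 * (q^3 + q^2 * s + 9 * c * (q * s^2) + c * s^3)
        = (3 * q)^3 + 3 * (3 * q)^2 * s + 81 * c * ((3 * q) * s^2) + 27 * c * s^3"
      by Groebner_Basis.algebra
    also have "\<dots> = 4 * s^3 - 135 * c * s^3"
      unfolding q by Groebner_Basis.algebra
    finally have "4 * s^3 - 135 * c * s^3 = - 27 * c * s^3"
      unfolding e4 m p' by simp
    then have "4 * (s^3 * (1 - 27 * c)) = 0"
      by (simp add: algebra_simps)
    then show False using four ps c by (metis mult_eq_0_iff power_not_zero)
  qed
  then show "q = 0" "s = p" using p by simp_all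
qed

section \<open>Group laws of the stabilizer, and its transitive and free action on fibres\<close>

lemma mat2_moebius_adj:
  assumes "mat2_det M \<noteq> 0"
  shows "mat2_moebius (mat2_adj M) (mat2_moebius M P) = P"
proof -
  have "mat2_moebius (mat2_adj M) (mat2_moebius M P) = mat2_moebius (mat2_mult (mat2_adj M) M) P"
    using assms by (subst mat2_moebius_mult) (simp_all add: mat2_det_adj)
  then show ?thesis
    unfolding mat2_mult_adj mat2_moebius_smult[OF assms] mat2_moebius_one .
qed

lemma form_stabilizer_mult:
  assumes "M \<in> form_stabilizer F" "N \<in> form_stabilizer F"
  shows "mat2_mult M N \<in> form_stabilizer F"
proof -
  obtain l m where M: "mat2_det M \<noteq> 0" "form_act F M = form_scale l F"
    and N: "mat2_det N \<noteq> 0" "form_act F N = form_scale m F"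
    using assms unfolding form_stabilizer_def by blast
  have "form_act F (mat2_mult M N) = form_scale (l * m) F"
    unfolding form_act_mult[symmetric] M(2) form_act_scale N(2) form_scale_scale ..
  with M(1) N(1) show ?thesis
    unfolding form_stabilizer_def by (auto simp: mat2_det_mult)
qed

lemma form_stabilizer_adj:
  assumes "form_disc F \<noteq> 0" "M \<in> form_stabilizer F"
  shows "mat2_adj M \<in> form_stabilizer F"
proof -
  obtain l where M: "mat2_det M \<noteq> 0" "form_act F M = form_scale l F"
    using assms(2) unfolding form_stabilizer_def by blast
  have "l \<noteq> 0" using form_stabilizer_scale_nonzero[OF assms(1) M] .
  then have "form_act F (mat2_adj M) = form_scale (mat2_det M ^ 3 / l) F"
    using form_scale_cancel[OF form_act_adj[OF M(2)]] by simp
  with M(1) show ?thesis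
    unfolding form_stabilizer_def by (auto simp: mat2_det_adj)
qed

text \<open>Both points are moved to infinity by matrices giving the same normal form. Going from
  \<open>P\<close> to infinity and on to \<open>Q\<close> preserves \<open>F\<close> up to a scalar,
  also when j is 1728.\<close>

lemma form_stabilizer_transitive:
  fixes F :: "'a::field cubic_form"
  assumes "(2::'a) \<noteq> 0" and "form_disc F \<noteq> 0"
    and P: "form_eval F (proj_x P) (proj_y P) \<noteq> 0" and Q: "form_eval F (proj_x Q) (proj_y Q) \<noteq> 0"
    and j: "form_j F P \<noteq> 0" "form_j F Q = form_j F P"
  obtains M where "M \<in> form_stabilizer F" "mat2_moebius M P = Q"
proof -
  let ?K = "canonical_form (form_disc F) (form_j F P)"
  obtain N l where N: "mat2_det N \<noteq> 0" "l \<noteq> 0" "mat2_moebius N Infty = P"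
    "form_act F N = form_scale l ?K"
    using canonical_form_exists[OF assms(1,2) P j(1)] .
  obtain N' l' where N': "mat2_det N' \<noteq> 0" "l' \<noteq> 0" "mat2_moebius N' Infty = Q"
    "form_act F N' = form_scale l' ?K"
    using canonical_form_exists[OF assms(1,2) Q] j by metis
  define M where "M = mat2_mult N' (mat2_adj N)"
  have det: "mat2_det M \<noteq> 0"
    using N N' by (simp add: M_def mat2_det_mult mat2_det_adj)
  have "form_act F M = form_scale l' (form_act ?K (mat2_adj N))"
    unfolding M_def form_act_mult[symmetric] N'(4) form_act_scale ..
  also have "form_act ?K (mat2_adj N) = form_scale (mat2_det N ^ 3 / l) F"
    using form_scale_cancel[OF form_act_adj[OF N(4)]] N(2) by simp
  finally have "M \<in> form_stabilizer F"
    using det unfolding form_stabilizer_def form_scale_scale by blast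
  moreover have "mat2_moebius M P = Q"
    using N N' mat2_moebius_adj[OF N(1), of Infty]
    by (simp add: M_def mat2_moebius_mult mat2_det_adj)
  ultimately show thesis using that by blast
qed

text \<open>Up to a scalar, \<open>R\<close> is the inverse of \<open>M'\<close> times
  \<open>M\<close>, and it fixes \<open>P\<close>. Conjugated by \<open>N\<close> it fixes infinity
  and preserves the normal form, hence is scalar. At 1728 this fails, since \<open>x -> -x\<close>
  preserves \<open>x^3 - D x y^2\<close>.\<close>

lemma form_stabilizer_free:
  fixes F :: "'a::field cubic_form"
  assumes two: "(2::'a) \<noteq> 0" and disc: "form_disc F \<noteq> 0"
    and P: "form_eval F (proj_x P) (proj_y P) \<noteq> 0" and j: "form_j F P \<noteq> 0" "form_j F P \<noteq> 1728"
    and M: "M \<in> form_stabilizer F" and M': "M' \<in> form_stabilizer F"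
    and eq: "mat2_moebius M P = mat2_moebius M' P"
  obtains l where "l \<noteq> 0" "M = mat2_smult l M'"
proof -
  define c where "c = 64 / (1728 - form_j F P)"
  obtain N k where N: "mat2_det N \<noteq> 0" "k \<noteq> 0" "mat2_moebius N Infty = P"
    "form_act F N = form_scale k (Cubic_Form 1 1 (9 * c) c)"
    using canonical_form_exists[OF two disc P j(1)] j(2) by (auto simp: canonical_form_def c_def)
  have det: "mat2_det M \<noteq> 0" "mat2_det M' \<noteq> 0"
    using M M' by (auto simp: form_stabilizer_def)
  define R where "R = mat2_mult (mat2_adj M') M"
  have R: "R \<in> form_stabilizer F"
    unfolding R_def using form_stabilizer_mult form_stabilizer_adj disc M M' by blast
  then obtain r where r: "mat2_det R \<noteq> 0" "form_act F R = form_scale r F"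
    unfolding form_stabilizer_def by blast
  have RP: "mat2_moebius R P = P"
    unfolding R_def using det eq by (simp add: mat2_moebius_mult mat2_det_adj mat2_moebius_adj)
  define L where "L = mat2_mult (mat2_adj N) (mat2_mult R N)"
  have detL: "mat2_det L \<noteq> 0"
    using N(1) r(1) by (simp add: L_def mat2_det_mult mat2_det_adj)
  have NL: "mat2_mult N L = mat2_smult (mat2_det N) (mat2_mult R N)"
    unfolding L_def mat2_mult_assoc[symmetric] mat2_mult_adj mat2_smult_mult mat2_mult_one ..
  have "form_scale k (form_act (Cubic_Form 1 1 (9 * c) c) L) = form_act F (mat2_mult N L)"
    unfolding form_act_mult[symmetric] N(4) form_act_scale ..
  also have "\<dots> = form_scale (mat2_det N ^ 3 * (r * k)) (Cubic_Form 1 1 (9 * c) c)"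
    unfolding NL form_act_smult form_act_mult[symmetric] r(2) form_act_scale N(4) form_scale_scale ..
  finally have L: "form_act (Cubic_Form 1 1 (9 * c) c) L
      = form_scale (mat2_det N ^ 3 * (r * k) / k) (Cubic_Form 1 1 (9 * c) c)"
    by (rule form_scale_cancel) fact
  have "mat2_moebius L Infty = Infty"
    using N r(1) RP mat2_moebius_adj[OF N(1), of Infty]
    by (simp add: L_def mat2_moebius_mult mat2_det_mult mat2_det_adj)
  then obtain p q s where L': "L = Mat2 p q 0 s"
    by (cases L) (auto split: if_splits)
  have "form_disc (Cubic_Form 1 1 (9 * c) c) \<noteq> 0"
    using form_disc_act[of F N] disc N(1) unfolding N(4) form_disc_scale by auto
  then have qs: "q = 0" "s = p"
    using canonical_form_stabilizer_trivial[OF two _ _ L[unfolded L']] detL by (auto simp: L')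
  \<comment> \<open>With \<open>L\<close> scalar, cancelling \<open>N\<close> through its adjugate
    shows that \<open>R\<close> is scalar. Multiplying by \<open>M'\<close> then shows that
    \<open>M\<close> is a multiple of \<open>M'\<close>.\<close>
  have "mat2_smult (mat2_det N) (mat2_mult R N) = mat2_smult p N"
    unfolding NL[symmetric] L' qs by (cases N) (simp add: mult.commute)
  then have "mat2_mult R N = mat2_smult (p / mat2_det N) N"
    by (rule mat2_smult_cancel) fact
  then have "mat2_mult (mat2_mult R N) (mat2_adj N)
      = mat2_mult (mat2_smult (p / mat2_det N) N) (mat2_adj N)"
    by simp
  then have "mat2_smult (mat2_det N) R = mat2_smult p (Mat2 1 0 0 1)"
    unfolding mat2_mult_assoc mat2_smult_mult mat2_mult_adj mat2_mult_one mat2_smult_smult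
    using N(1) by simp
  then have R1: "R = mat2_smult (p / mat2_det N) (Mat2 1 0 0 1)"
    by (rule mat2_smult_cancel) fact
  have "mat2_smult (mat2_det M') M = mat2_mult M' R"
    unfolding R_def mat2_mult_assoc[symmetric] mat2_mult_adj mat2_smult_mult mat2_mult_one ..
  also have "\<dots> = mat2_smult (p / mat2_det N) M'"
    unfolding R1 mat2_smult_mult mat2_mult_one ..
  finally have "M = mat2_smult (p / mat2_det N / mat2_det M') M'"
    by (rule mat2_smult_cancel) fact
  moreover have "p / mat2_det N / mat2_det M' \<noteq> 0"
    using detL N(1) det qs by (simp add: L')
  ultimately show thesis using that by blast
qed

subsection \<open>Automorphisms over the algebraic closure\<close>

lemma cubic_split:
  fixes g :: "'a::alg_closed_field poly"
  assumes "Polynomial.degree g = 3" "rsquarefree g"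
  obtains a u v w where "a \<noteq> 0" "u \<noteq> v" "u \<noteq> w" "v \<noteq> w"
    "g = smult a ([:- u, 1:] * [:- v, 1:] * [:- w, 1:])"
proof -
  have g0: "g \<noteq> 0" using assms by auto
  obtain A where A: "size A = 3" "g = smult (lead_coeff g) (\<Prod>x\<in>#A. [:- x, 1:])"
    using alg_closed_imp_factorization[OF g0] assms(1) by auto
  obtain xs where xs: "mset xs = A" by (metis ex_mset)
  with A(1) have "length xs = 3" by (metis size_mset)
  then obtain u v w where "xs = [u, v, w]"
    by (auto simp: numeral_3_eq_3 length_Suc_conv)
  with xs have "A = {#u, v, w#}" by simp
  then have g: "g = smult (lead_coeff g) ([:- u, 1:] * [:- v, 1:] * [:- w, 1:])"
    using A(2) by (simp only: image_mset_add_mset image_mset_empty prod_mset.add_mset prod_mset.empty)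
      (simp only: mult.assoc mult_1_right)
  have dvd: "x \<noteq> y" if "[:- x, 1:] * [:- y, 1:] dvd g" for x y
  proof
    assume "x = y"
    then have "[:- x, 1:] ^ 2 dvd g" using that by (simp only: power2_eq_square)
    then have "order x g \<ge> 2" using g0 by (simp only: order_divides) simp
    moreover have "order x g \<le> 1" using assms(2) unfolding rsquarefree_def by (metis order_refl zero_le)
    ultimately show False by simp
  qed
  have "g = [:- u, 1:] * [:- v, 1:] * smult (lead_coeff g) [:- w, 1:]"
    "g = [:- u, 1:] * [:- w, 1:] * smult (lead_coeff g) [:- v, 1:]"
    "g = [:- v, 1:] * [:- w, 1:] * smult (lead_coeff g) [:- u, 1:]"
    using g by (simp_all only: mult_smult_right mult_ac)
  then have "u \<noteq> v" "u \<noteq> w" "v \<noteq> w"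
    by (metis dvd dvd_triv_left)+
  with that g g0 show thesis by (metis leading_coeff_0_iff)
qed

lemma cubic_form_of_split:
  "cubic_form_of (smult a ([:- u, 1:] * [:- v, 1:] * [:- w, 1:]))
     = Cubic_Form a (- a * (u + v + w)) (a * (u * v + u * w + v * w)) (- a * u * v * w)"
proof -
  have "smult a ([:- u, 1:] * [:- v, 1:] * [:- w, 1:])
      = [:- a * u * v * w, a * (u * v + u * w + v * w), - a * (u + v + w), a:]"
    by (simp add: algebra_simps)
  then show ?thesis by (simp only: cubic_form_of_pCons)
qed

lemma form_disc_split:
  "form_disc (Cubic_Form a (- a * (u + v + w)) (a * (u * v + u * w + v * w)) (- a * u * v * w))
     = a^4 * ((u - v) * (u - w) * (v - w))^2"
  by (simp, Groebner_Basis.algebra)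

text \<open>If the roots are permuted, the transformed form vanishes at the same three points and so
  is proportional to the original. Conversely, an invertible map sending the finite root set into
  itself permutes it.\<close>

lemma bij_betw_roots_iff:
  fixes g :: "'a::alg_closed_field poly"
  assumes deg: "Polynomial.degree g = 3" and sqf: "rsquarefree g" and det: "mat2_det M \<noteq> 0"
  defines "R \<equiv> Pt ` {z. poly g z = 0}"
  shows "bij_betw (mat2_moebius M) R R
    \<longleftrightarrow> (\<exists>l. form_act (cubic_form_of g) M = form_scale l (cubic_form_of g))"
proof -
  obtain a u v w where a: "a \<noteq> 0" and uvw: "u \<noteq> v" "u \<noteq> w" "v \<noteq> w"
    and g: "g = smult a ([:- u, 1:] * [:- v, 1:] * [:- w, 1:])"
    using cubic_split[OF deg sqf] by metis
  have root: "poly g z = 0 \<longleftrightarrow> z \<in> {u, v, w}" for z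
    unfolding g poly_smult poly_mult using a by auto
  obtain a' b c d where F: "cubic_form_of g = Cubic_Form a' b c d" by (cases "cubic_form_of g")
  have "a' = a"
    using F unfolding g cubic_form_of_split by simp
  note F = F[unfolded this]
  have eval: "form_eval (cubic_form_of g) z 1 = poly g z" for z
    using poly_eq_form_eval[OF deg] by simp
  have F_disc: "form_disc (cubic_form_of g) \<noteq> 0"
    unfolding g cubic_form_of_split form_disc_split using a uvw by simp
  show ?thesis
  proof
    assume bij: "bij_betw (mat2_moebius M) R R"
    obtain p q r s where G: "form_act (cubic_form_of g) M = Cubic_Form p q r s"
      by (cases "form_act (cubic_form_of g) M")
    have zero: "form_eval (Cubic_Form p q r s) z 1 = 0" if "z \<in> {u, v, w}" for z
    proof -
      have "mat2_moebius M (Pt z) \<in> R"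
        using bij that root by (auto simp: R_def dest: bij_betwE)
      then obtain z' where z': "mat2_moebius M (Pt z) = Pt z'" "poly g z' = 0"
        by (auto simp: R_def)
      then show ?thesis
        using form_eval_moebius_eq_0_iff[OF det, of "cubic_form_of g" "Pt z"]
        by (simp add: eval G)
    qed
    \<comment> \<open>Chosen to cancel the cubic terms: \<open>h\<close> below has degree at most 2
      but three zeros.\<close>
    define l where "l = p / a"
    have p: "p = l * a" using a by (simp add: l_def)
    define h where "h = [:s - l * d, r - l * c, q - l * b:]"
    have "h = 0"
    proof (rule poly_eqI_degree[where A = "{u, v, w}"])
      show "poly h z = poly 0 z" if "z \<in> {u, v, w}" for z
      proof -
        have "poly h z = form_eval (Cubic_Form p q r s) z 1 - l * form_eval (cubic_form_of g) z 1"
          by (simp add: h_def F p algebra_simps power2_eq_square)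
        then show ?thesis using zero[OF that] eval[of z] root[of z] that by simp
      qed
    qed (use uvw in \<open>simp_all add: h_def\<close>)
    then have "form_act (cubic_form_of g) M = form_scale l (cubic_form_of g)"
      using G by (simp add: F p h_def)
    then show "\<exists>l. form_act (cubic_form_of g) M = form_scale l (cubic_form_of g)" ..
  next
    assume "\<exists>l. form_act (cubic_form_of g) M = form_scale l (cubic_form_of g)"
    then obtain l where l: "form_act (cubic_form_of g) M = form_scale l (cubic_form_of g)" ..
    have inj: "inj_on (mat2_moebius M) R"
      by (rule inj_on_inverseI) (rule mat2_moebius_adj[OF det])
    moreover have "mat2_moebius M ` R \<subseteq> R"
    proof
      fix P assume "P \<in> mat2_moebius M ` R"
      then obtain z where z: "poly g z = 0" "P = mat2_moebius M (Pt z)" by (auto simp: R_def)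
      have eval0: "form_eval (cubic_form_of g) (proj_x P) (proj_y P) = 0"
        unfolding z form_eval_moebius_eq_0_iff[OF det] l form_eval_scale using z eval by simp
      show "P \<in> R"
      proof (cases P)
        case (Pt x)
        with eval0 show ?thesis by (simp add: R_def eval)
      next
        case Infty
        with eval0 a show ?thesis by (simp add: F)
      qed
    qed
    moreover have "finite R"
      unfolding R_def root by simp
    ultimately show "bij_betw (mat2_moebius M) R R"
      by (simp add: bij_betw_def endo_inj_surj)
  qed
qed

section \<open>Descent from the algebraic closure to the base field\<close>

lemma form_act_map_to_ac:
  "form_act (map_cubic_form to_ac F) (map_mat2 to_ac M) = map_cubic_form to_ac (form_act F M)"
  by (cases F; cases M) simp

lemma form_scale_map_to_ac:
  "form_scale (to_ac l) (map_cubic_form to_ac F) = map_cubic_form to_ac (form_scale l F)"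
  by (cases F) simp

lemma form_disc_map_to_ac: "form_disc (map_cubic_form to_ac F) = to_ac (form_disc F)"
  by (cases F) simp

lemma mat2_det_map_to_ac: "mat2_det (map_mat2 to_ac M) = to_ac (mat2_det M)"
  by (cases M) simp

lemma mat2_moebius_map_to_ac:
  "mat2_moebius (map_mat2 to_ac M) (map_proj_line to_ac P) = map_proj_line to_ac (mat2_moebius M P)"
  by (cases M; cases P) (auto simp flip: to_ac_mult to_ac_add to_ac_divide)

lemma degree_to_closure: "Polynomial.degree (to_closure g) = Polynomial.degree g"
  by (rule degree_map_poly) simp

lemma cubic_form_of_to_closure: "cubic_form_of (to_closure g) = map_cubic_form to_ac (cubic_form_of g)"
  by (simp add: cubic_form_of_def coeff_map_poly)

lemma form_disc_separable:
  assumes "Polynomial.degree g = 3" "separable_poly g"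
  shows "form_disc (cubic_form_of g) \<noteq> 0"
proof -
  obtain a u v w where "a \<noteq> 0" "u \<noteq> v" "u \<noteq> w" "v \<noteq> w"
    and g: "to_closure g = smult a ([:- u, 1:] * [:- v, 1:] * [:- w, 1:])"
    using cubic_split[of "to_closure g"] assms unfolding degree_to_closure separable_poly_def by metis
  then have "form_disc (cubic_form_of (to_closure g)) \<noteq> 0"
    unfolding g cubic_form_of_split form_disc_split by simp
  then show ?thesis
    unfolding cubic_form_of_to_closure form_disc_map_to_ac by simp
qed

text \<open>A factor of proportionality found over the closure is the quotient of the coefficients
  of \<open>x^3\<close>, hence lies in the base field.\<close>

lemma form_act_map_to_ac_scale_iff:
  assumes "form_eval F 1 0 \<noteq> 0"
  shows "(\<exists>l. form_act (map_cubic_form to_ac F) (map_mat2 to_ac M) = form_scale l (map_cubic_form to_ac F))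
    \<longleftrightarrow> (\<exists>l. form_act F M = form_scale l F)"
proof
  assume "\<exists>l. form_act (map_cubic_form to_ac F) (map_mat2 to_ac M) = form_scale l (map_cubic_form to_ac F)"
  then obtain l where l: "map_cubic_form to_ac (form_act F M) = form_scale l (map_cubic_form to_ac F)"
    unfolding form_act_map_to_ac ..
  obtain a b c d where F: "F = Cubic_Form a b c d" by (cases F)
  obtain p q r s where G: "form_act F M = Cubic_Form p q r s" by (cases "form_act F M")
  have "l = to_ac (p / a)"
    using l[unfolded G] assms unfolding F by (auto simp: field_simps)
  then have "map_cubic_form to_ac (form_act F M) = map_cubic_form to_ac (form_scale (p / a) F)"
    using l form_scale_map_to_ac by metis
  then have "form_act F M = form_scale (p / a) F"
    by (rule injD[OF cubic_form.inj_map[OF inj_to_ac]])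
  then show "\<exists>l. form_act F M = form_scale l F" ..
next
  assume "\<exists>l. form_act F M = form_scale l F"
  then show "\<exists>l. form_act (map_cubic_form to_ac F) (map_mat2 to_ac M) = form_scale l (map_cubic_form to_ac F)"
    using form_act_map_to_ac form_scale_map_to_ac by metis
qed

definition geometric_aut :: "'k::field mat2 \<Rightarrow> 'k alg_closure proj_line \<Rightarrow> 'k alg_closure proj_line" where
  "geometric_aut M = mat2_moebius (map_mat2 to_ac M)"

lemma geometric_aut_smult:
  assumes "l \<noteq> 0"
  shows "geometric_aut (mat2_smult l M) = geometric_aut M"
proof -
  have "map_mat2 to_ac (mat2_smult l M) = mat2_smult (to_ac l) (map_mat2 to_ac M)"
    by (cases M) simp
  then show ?thesis using assms by (simp add: geometric_aut_def mat2_moebius_smult)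
qed

text \<open>Rational points embed into the points over the closure. This lets equal automorphisms be
  treated as equal maps on the set where fibres are counted.\<close>

lemma geometric_aut_eqD:
  assumes "geometric_aut M = geometric_aut N"
  shows "mat2_moebius M = mat2_moebius N"
proof
  fix P
  have "map_proj_line to_ac (mat2_moebius M P) = map_proj_line to_ac (mat2_moebius N P)"
    using assms unfolding geometric_aut_def mat2_moebius_map_to_ac[symmetric] by simp
  then show "mat2_moebius M P = mat2_moebius N P"
    by (rule injD[OF proj_line.inj_map[OF inj_to_ac]])
qed

text \<open>Taking the image under \<open>geometric_aut\<close> counts automorphisms instead of
  matrices, since proportional matrices give the same map.\<close>

lemma num_root_auts_eq:
  assumes "Polynomial.degree g = 3" "separable_poly g"
  shows "num_root_auts g = card (geometric_aut ` form_stabilizer (cubic_form_of g))"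
proof -
  obtain a b c d where "g = [:d, c, b, a:]" "a \<noteq> 0"
    using cubic_poly_eq[OF assms(1)] by metis
  then have "form_eval (cubic_form_of g) 1 0 \<noteq> 0"
    by simp
  then have bij: "bij_betw (geometric_aut M) (geometric_roots g) (geometric_roots g)
      \<longleftrightarrow> M \<in> form_stabilizer (cubic_form_of g)" if "mat2_det M \<noteq> 0" for M
    using bij_betw_roots_iff[of "to_closure g" "map_mat2 to_ac M"] that assms
    unfolding degree_to_closure separable_poly_def mat2_det_map_to_ac cubic_form_of_to_closure
      geometric_aut_def geometric_roots_def form_stabilizer_def
    by (simp add: form_act_map_to_ac_scale_iff)
  have auts: "proj_line_auts = geometric_aut ` {M :: 'a mat2. mat2_det M \<noteq> 0}" (is "?A = ?B")
  proof
    show "?A \<subseteq> ?B"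
    proof
      fix \<phi> :: "'a alg_closure proj_line \<Rightarrow> _" assume "\<phi> \<in> ?A"
      then obtain a b c d :: 'a where *: "\<phi> = moebius (to_ac a) (to_ac b) (to_ac c) (to_ac d)" "a * d - b * c \<noteq> 0"
        by (auto simp: proj_line_auts_def)
      then have "\<phi> = geometric_aut (Mat2 a b c d)" "mat2_det (Mat2 a b c d) \<noteq> 0"
        by (simp_all add: geometric_aut_def)
      then show "\<phi> \<in> ?B" by blast
    qed
    show "?B \<subseteq> ?A"
    proof
      fix \<phi> :: "'a alg_closure proj_line \<Rightarrow> _" assume "\<phi> \<in> ?B"
      then obtain M :: "'a mat2" where *: "\<phi> = geometric_aut M" "mat2_det M \<noteq> 0" by blast
      obtain a b c d where "M = Mat2 a b c d" by (cases M)
      with * have "\<phi> = moebius (to_ac a) (to_ac b) (to_ac c) (to_ac d)" "a * d - b * c \<noteq> 0"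
        by (simp_all add: geometric_aut_def)
      then show "\<phi> \<in> ?A" unfolding proj_line_auts_def by blast
    qed
  qed
  have "{\<phi> \<in> proj_line_auts. bij_betw \<phi> (geometric_roots g) (geometric_roots g)}
      = geometric_aut ` form_stabilizer (cubic_form_of g)"
    unfolding auts using bij by (auto simp: form_stabilizer_def)
  then show ?thesis by (simp add: num_root_auts_def)
qed

subsection \<open>Fibres of the j-invariant\<close>

text \<open>Compares the orbit map \<open>M -> M P\<close> with \<open>geometric_aut\<close> on the
  stabilizer. Exchanging their roles gives the upper and the lower bound for a fibre.\<close>

lemma card_image_le_of_factor:
  assumes "finite A" and "\<And>x y. x \<in> A \<Longrightarrow> y \<in> A \<Longrightarrow> g x = g y \<Longrightarrow> f x = f y"
  shows "card (f ` A) \<le> card (g ` A)"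
proof -
  have "f ` A = (\<lambda>z. f (inv_into A g z)) ` g ` A"
  proof -
    have "f (inv_into A g (g x)) = f x" if "x \<in> A" for x
      using that by (intro assms(2)) (auto intro: inv_into_into f_inv_into_f)
    then show ?thesis by (simp add: image_image)
  qed
  then show ?thesis using assms(1) by (metis card_image_le finite_imageI)
qed

lemma finite_UNIV_mat2: "finite (UNIV :: 'a::finite mat2 set)"
proof -
  have "(UNIV :: 'a mat2 set) = (\<lambda>(p, q, r, s). Mat2 p q r s) ` UNIV"
  proof (rule sym, rule surjI)
    show "(\<lambda>(p, q, r, s). Mat2 p q r s) (case M of Mat2 p q r s \<Rightarrow> (p, q, r, s)) = M" for M :: "'a mat2"
      by (cases M) simp
  qed
  then show ?thesis by (metis finite finite_imageI)
qed

lemma finite_UNIV_proj_line: "finite (UNIV :: 'a::finite proj_line set)"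
proof -
  have "(UNIV :: 'a proj_line set) = insert Infty (range Pt)"
    by (auto intro: proj_line.exhaust)
  then show ?thesis by (metis finite finite_imageI finite_insert)
qed

text \<open>At a root of \<open>F\<close> the quotient \<open>form_j\<close> divides by zero and
  yields 0, so without the first condition the roots would enter the fibre over 0.\<close>

definition form_j_fibre :: "'a::field cubic_form \<Rightarrow> 'a \<Rightarrow> 'a proj_line set" where
  "form_j_fibre F t = {P. form_eval F (proj_x P) (proj_y P) \<noteq> 0 \<and> form_j F P = t}"

lemma form_j_fibre_eq_orbit:
  fixes F :: "'a::field cubic_form"
  assumes "(2::'a) \<noteq> 0" "form_disc F \<noteq> 0" "P \<in> form_j_fibre F t" "t \<noteq> 0"
  shows "form_j_fibre F t = (\<lambda>M. mat2_moebius M P) ` form_stabilizer F"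
proof
  have P: "form_eval F (proj_x P) (proj_y P) \<noteq> 0" "form_j F P = t"
    using assms(3) by (auto simp: form_j_fibre_def)
  show "form_j_fibre F t \<subseteq> (\<lambda>M. mat2_moebius M P) ` form_stabilizer F"
  proof
    fix Q assume "Q \<in> form_j_fibre F t"
    then have Q: "form_eval F (proj_x Q) (proj_y Q) \<noteq> 0" "form_j F Q = form_j F P"
      using P by (auto simp: form_j_fibre_def)
    have "form_j F P \<noteq> 0" using P assms(4) by simp
    then obtain M where "M \<in> form_stabilizer F" "mat2_moebius M P = Q"
      using form_stabilizer_transitive[OF assms(1,2) P(1) Q(1) _ Q(2)] by metis
    then show "Q \<in> (\<lambda>M. mat2_moebius M P) ` form_stabilizer F" by blast
  qed
  show "(\<lambda>M. mat2_moebius M P) ` form_stabilizer F \<subseteq> form_j_fibre F t"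
  proof
    fix Q assume "Q \<in> (\<lambda>M. mat2_moebius M P) ` form_stabilizer F"
    then obtain M where M: "M \<in> form_stabilizer F" "Q = mat2_moebius M P" by blast
    show "Q \<in> form_j_fibre F t"
      using form_stabilizer_moebius[OF assms(2) M(1), of P] P by (simp add: form_j_fibre_def M(2))
  qed
qed

lemma card_form_j_fibre_le:
  fixes F :: "'a::{field, finite} cubic_form"
  assumes "(2::'a) \<noteq> 0" "form_disc F \<noteq> 0" "t \<noteq> 0"
  shows "card (form_j_fibre F t) \<le> card (geometric_aut ` form_stabilizer F)"
proof (cases "form_j_fibre F t = {}")
  case False
  then obtain P where P: "P \<in> form_j_fibre F t" by blast
  show ?thesis
    unfolding form_j_fibre_eq_orbit[OF assms(1,2) P assms(3)]
    by (rule card_image_le_of_factor) (auto intro: finite_subset[OF _ finite_UNIV_mat2] dest: geometric_aut_eqD)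
qed simp

text \<open>The fibre is a single orbit, and away from 0 and 1728 two stabilizer elements with the
  same effect on \<open>P\<close> are proportional.\<close>

lemma card_form_j_fibre_eq:
  fixes F :: "'a::{field, finite} cubic_form"
  assumes "(2::'a) \<noteq> 0" "form_disc F \<noteq> 0" "t \<noteq> 0" "t \<noteq> 1728" "form_j_fibre F t \<noteq> {}"
  shows "card (form_j_fibre F t) = card (geometric_aut ` form_stabilizer F)"
proof (rule antisym)
  show "card (form_j_fibre F t) \<le> card (geometric_aut ` form_stabilizer F)"
    by (rule card_form_j_fibre_le) fact+
  obtain P where P: "P \<in> form_j_fibre F t" using assms(5) by blast
  show "card (geometric_aut ` form_stabilizer F) \<le> card (form_j_fibre F t)"
    unfolding form_j_fibre_eq_orbit[OF assms(1,2) P assms(3)]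
  proof (rule card_image_le_of_factor)
    show "finite (form_stabilizer F)" by (rule finite_subset[OF _ finite_UNIV_mat2]) simp
    fix M N assume "M \<in> form_stabilizer F" "N \<in> form_stabilizer F" "mat2_moebius M P = mat2_moebius N P"
    then obtain l where "l \<noteq> 0" "M = mat2_smult l N"
      using form_stabilizer_free[OF assms(1,2), of P M N] P assms(3,4) unfolding form_j_fibre_def by auto
    then show "geometric_aut M = geometric_aut N" by (simp add: geometric_aut_smult)
  qed
qed

text \<open>Either cubing is bijective on the field and the two terms can be swapped, or the field contains
  a primitive cube root of unity.\<close>

lemma diagonal_form_stabilizer_nontrivial:
  fixes a d :: "'a::{field, finite}"
  assumes "a \<noteq> 0" "d \<noteq> 0"
  obtains M P where "M \<in> form_stabilizer (Cubic_Form a 0 0 d)" "mat2_moebius M P \<noteq> P"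
proof (cases "inj (\<lambda>x :: 'a. x ^ 3)")
  case True
  then have "surj (\<lambda>x :: 'a. x ^ 3)" by (simp add: finite_UNIV_inj_surj)
  then obtain \<beta> where \<beta>: "d / a = \<beta> ^ 3" by (meson surjD)
  then have nz: "\<beta> \<noteq> 0" using assms by auto
  from \<beta> have "d = a * \<beta> ^ 3" using assms by (simp add: field_simps)
  then have "form_act (Cubic_Form a 0 0 d) (Mat2 0 \<beta> (1 / \<beta>) 0) = form_scale 1 (Cubic_Form a 0 0 d)"
    using nz by (simp add: power_one_over)
  then have "Mat2 0 \<beta> (1 / \<beta>) 0 \<in> form_stabilizer (Cubic_Form a 0 0 d)"
    using nz by (auto intro: form_stabilizerI simp del: form_act.simps form_scale.simps)
  moreover have "mat2_moebius (Mat2 0 \<beta> (1 / \<beta>) 0) Infty \<noteq> Infty"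
    using nz by simp
  ultimately show thesis by (rule that)
next
  case False
  then obtain x y :: 'a where xy: "x ^ 3 = y ^ 3" "x \<noteq> y" by (auto simp: inj_def)
  then have y: "y \<noteq> 0" "x \<noteq> 0" by auto
  have "form_act (Cubic_Form a 0 0 d) (Mat2 (x / y) 0 0 1) = form_scale 1 (Cubic_Form a 0 0 d)"
    using y xy by (simp add: power_divide)
  then have "Mat2 (x / y) 0 0 1 \<in> form_stabilizer (Cubic_Form a 0 0 d)"
    using y by (auto intro: form_stabilizerI simp del: form_act.simps form_scale.simps)
  moreover have "mat2_moebius (Mat2 (x / y) 0 0 1) (Pt 1) \<noteq> Pt 1"
    using xy y by simp
  ultimately show thesis by (rule that)
qed

text \<open>Multiplying the two equations gives \<open>b c = 0\<close> or
  \<open>b c = 9 a d\<close>, and the latter makes the discriminant vanish. The direct computation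
  also covers characteristic 3, where the relation \<open>disc(H) = -3 D\<close> would give
  nothing.\<close>

lemma diagonal_of_hessian_zero:
  fixes a b c d :: "'a::field"
  assumes H: "b^2 = 3 * a * c" "c^2 = 3 * b * d" and nz: "a \<noteq> 0" "d \<noteq> 0"
    and disc: "form_disc (Cubic_Form a b c d) \<noteq> 0"
  shows "b = 0" "c = 0"
proof -
  have "(b * c) * (b * c) = b^2 * c^2" by (simp add: power2_eq_square mult_ac)
  also have "\<dots> = (b * c) * (9 * a * d)" unfolding H by simp
  finally have "b * c = 0 \<or> b * c = 9 * a * d" by (metis mult_cancel_left)
  moreover have "b * c \<noteq> 9 * a * d"
  proof
    assume bc: "b * c = 9 * a * d"
    have "form_disc (Cubic_Form a b c d)
        = (b * c)^2 - 4 * a * c * c^2 - 4 * b^2 * b * d - 27 * a^2 * d^2 + 18 * a * d * (b * c)"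
      by (simp add: power2_eq_square power3_eq_cube mult_ac)
    also have "\<dots> = (b * c)^2 - 6 * a * d * (b * c) - 27 * a^2 * d^2"
      unfolding H by (simp add: algebra_simps)
    also have "\<dots> = 0" unfolding bc by (simp add: power2_eq_square algebra_simps)
    finally show False using disc by contradiction
  qed
  ultimately have "b = 0 \<or> c = 0" by simp
  then show "b = 0" "c = 0" using H by auto
qed

text \<open>A fibre with at most one point is bounded by the identity alone. Two points are moved to
  infinity and 0, where the form becomes diagonal and has a second symmetry.\<close>

lemma card_form_j_fibre_0_le:
  fixes F :: "'a::{field, finite} cubic_form"
  assumes two: "(2::'a) \<noteq> 0" and disc: "form_disc F \<noteq> 0"
  shows "card (form_j_fibre F 0) \<le> card (geometric_aut ` form_stabilizer F)"
proof -
  have fin: "finite (geometric_aut ` form_stabilizer F)"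
    by (rule finite_imageI, rule finite_subset[OF _ finite_UNIV_mat2]) simp
  have one: "Mat2 1 0 0 1 \<in> form_stabilizer F"
    unfolding form_stabilizer_def using form_act_one[of F] form_scale_one[of F] by (auto intro!: exI[of _ 1])
  have finf: "finite (form_j_fibre F 0)"
    by (rule finite_subset[OF _ finite_UNIV_proj_line]) simp
  show ?thesis
  proof (cases "\<exists>P Q. P \<in> form_j_fibre F 0 \<and> Q \<in> form_j_fibre F 0 \<and> P \<noteq> Q")
    case False
    then have "card (form_j_fibre F 0) \<le> 1"
      using card_le_Suc0_iff_eq[OF finf] by auto
    also have "1 \<le> card (geometric_aut ` form_stabilizer F)"
      using fin one by (metis One_nat_def Suc_leI card_gt_0_iff empty_iff imageI)
    finally show ?thesis .
  next
    case True
    then obtain P Q where P: "P \<in> form_j_fibre F 0" and Q: "Q \<in> form_j_fibre F 0" and "P \<noteq> Q"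
      by blast
    \<comment> \<open>The columns are the coordinates of \<open>P\<close> and \<open>Q\<close>, so
      infinity goes to \<open>P\<close> and 0 goes to \<open>Q\<close>.\<close>
    define N where "N = Mat2 (proj_x P) (proj_x Q) (proj_y P) (proj_y Q)"
    have N: "mat2_det N \<noteq> 0"
      using \<open>P \<noteq> Q\<close> by (cases P; cases Q) (auto simp: N_def)
    have NP: "mat2_moebius N Infty = P" and NQ: "mat2_moebius N (Pt 0) = Q"
      by (cases P; cases Q; simp add: N_def)+
    obtain a b c d where G: "form_act F N = Cubic_Form a b c d" by (cases "form_act F N")
    have discG: "form_disc (Cubic_Form a b c d) \<noteq> 0"
      using form_disc_act[of F N] disc N unfolding G by simp
    have "(256::'a) \<noteq> 0"
      using power_not_zero[OF two, of 8] by simp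
    then have H0: "hessian (form_act F N) (proj_x R) (proj_y R) = 0"
      and E0: "form_eval (form_act F N) (proj_x R) (proj_y R) \<noteq> 0"
      if "mat2_moebius N R \<in> form_j_fibre F 0" for R
      using that form_j_act[OF N, of F R] form_eval_moebius_eq_0_iff[OF N, of F R] discG
      by (auto simp: form_j_fibre_def form_j_def G)
    have ad: "a \<noteq> 0" "d \<noteq> 0"
      using E0[of Infty] E0[of "Pt 0"] P Q by (simp_all add: NP NQ G)
    have "b^2 = 3 * a * c" "c^2 = 3 * b * d"
      using H0[of Infty] H0[of "Pt 0"] P Q by (simp_all add: NP NQ G)
    then have bc: "b = 0" "c = 0"
      using diagonal_of_hessian_zero ad discG by blast+
    have "form_disc (Cubic_Form a 0 0 d) = (9 * a * d) * (- 3 * a * d)"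
      by (simp add: power2_eq_square)
    \<comment> \<open>The discriminant is \<open>-27 a^2 d^2\<close>, so 3 is nonzero here. The
      Hessian \<open>-9 a d x y\<close> then vanishes only at infinity and 0.\<close>
    then have nine: "9 * a * d \<noteq> 0"
      using discG unfolding bc by (metis mult_zero_left)
    have "form_j_fibre F 0 \<subseteq> {P, Q}"
    proof
      fix R assume R: "R \<in> form_j_fibre F 0"
      define R' where "R' = mat2_moebius (mat2_adj N) R"
      have NR': "mat2_moebius N R' = R"
        unfolding R'_def using mat2_moebius_adj[of "mat2_adj N" R] N
        by (simp add: mat2_det_adj mat2_adj_adj)
      have "hessian (form_act F N) (proj_x R') (proj_y R') = 0"
        using H0[of R'] R by (simp add: NR')
      then have "proj_x R' * proj_y R' = 0"
        using nine by (simp add: G bc)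
      then have "R' = Infty \<or> R' = Pt 0" by (cases R') auto
      then show "R \<in> {P, Q}" using NR' NP NQ by auto
    qed
    then have "card (form_j_fibre F 0) \<le> card {P, Q}" by (intro card_mono) simp_all
    also have "\<dots> \<le> 2" by (simp add: card_insert_le_m1)
    also have "2 \<le> card (geometric_aut ` form_stabilizer F)"
    proof -
      obtain M R where M: "M \<in> form_stabilizer (form_act F N)" and R: "mat2_moebius M R \<noteq> R"
        using diagonal_form_stabilizer_nontrivial[OF ad] unfolding G bc by metis
      obtain m where m: "mat2_det M \<noteq> 0" "form_act (form_act F N) M = form_scale m (form_act F N)"
        using M unfolding form_stabilizer_def by blast
      \<comment> \<open>The symmetry of the diagonal form is conjugated back to \<open>F\<close>. It
        moves the image of \<open>R\<close> and so differs from the identity.\<close>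
      define L where "L = mat2_mult N (mat2_mult M (mat2_adj N))"
      have L: "mat2_det L \<noteq> 0"
        using N m(1) by (simp add: L_def mat2_det_mult mat2_det_adj)
      have "form_act F L = form_scale (m * mat2_det N ^ 3) F"
        unfolding L_def form_act_mult[symmetric] m(2) form_act_scale
        unfolding form_act_mult mat2_mult_adj form_act_smult form_act_one form_scale_scale ..
      with L have Ls: "L \<in> form_stabilizer F" unfolding form_stabilizer_def by blast
      have "mat2_moebius L (mat2_moebius N R) = mat2_moebius N (mat2_moebius M R)"
        using N m(1) by (simp add: L_def mat2_moebius_mult mat2_det_mult mat2_det_adj mat2_moebius_adj)
      also have "\<dots> \<noteq> mat2_moebius N R"
        using R mat2_moebius_adj[OF N] by metis
      finally have "mat2_moebius L \<noteq> mat2_moebius (Mat2 1 0 0 1)"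
        using mat2_moebius_one by metis
      then have "geometric_aut L \<noteq> geometric_aut (Mat2 1 0 0 1)"
        using geometric_aut_eqD by blast
      then have "card {geometric_aut L, geometric_aut (Mat2 1 0 0 1)} = 2" by simp
      moreover have "{geometric_aut L, geometric_aut (Mat2 1 0 0 1)} \<subseteq> geometric_aut ` form_stabilizer F"
        using Ls one by blast
      ultimately show ?thesis using card_mono[OF fin] by metis
    qed
    finally show ?thesis .
  qed
qed

section \<open>Compatible curves and the count of exceptional values\<close>

lemma form_eval_Infty:
  assumes "Polynomial.degree g = 3"
  shows "form_eval (cubic_form_of g) (proj_x Infty) (proj_y Infty) \<noteq> 0"
proof -
  obtain a b c d where "g = [:d, c, b, a:]" "a \<noteq> 0"
    using cubic_poly_eq[OF assms] by metis
  then show ?thesis by simp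
qed

lemma to_closure_mult: "to_closure (g * h) = to_closure g * to_closure h"
  by (rule poly_eqI) (simp add: coeff_map_poly coeff_mult to_ac_sum)

lemma separable_poly_factor:
  assumes "separable_poly (g * h)"
  shows "separable_poly g"
proof -
  have sqf: "rsquarefree (to_closure g * to_closure h)"
    using assms unfolding separable_poly_def by (simp only: to_closure_mult)
  then have nz: "to_closure g * to_closure h \<noteq> 0" unfolding rsquarefree_def by blast
  have "order z (to_closure g) \<le> order z (to_closure g * to_closure h)" for z
    using order_mult[OF nz] by simp
  moreover have "order z (to_closure g * to_closure h) \<le> 1" for z
    using sqf unfolding rsquarefree_def by (metis order_refl zero_le)
  ultimately have "order z (to_closure g) \<le> 1" for z by (metis order_trans)
  then have "order z (to_closure g) = 0 \<or> order z (to_closure g) = 1" for z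
    by (metis One_nat_def le_0_eq le_Suc_eq)
  then show ?thesis
    using nz unfolding separable_poly_def rsquarefree_def by auto
qed

lemma two_neq_zero_of_odd_CHAR:
  assumes "odd CHAR('a::field)"
  shows "(2::'a) \<noteq> 0"
proof
  assume "(2::'a) = 0"
  then have "CHAR('a) dvd 2"
    by (metis of_nat_eq_0_iff_char_dvd of_nat_numeral)
  then have "CHAR('a) = 1 \<or> CHAR('a) = 2"
    by (metis prime_nat_iff two_is_prime_nat)
  then show False using assms by simp
qed

text \<open>Isomorphism and the twist by \<open>c\<close> leave j unchanged, so every compatible
  curve has the j of some \<open>curve_at g P\<close>. Conversely these curves are elliptic and are
  themselves compatible, with \<open>c = 1\<close>.\<close>

lemma compatible_j_invariants_eq:
  fixes g :: "'a::field poly"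
  assumes two: "(2::'a) \<noteq> 0" and deg: "Polynomial.degree g = 3" and disc: "form_disc (cubic_form_of g) \<noteq> 0"
  shows "compatible_j_invariants g
    = form_j (cubic_form_of g) ` {P. form_eval (cubic_form_of g) (proj_x P) (proj_y P) \<noteq> 0}"
    (is "?T = ?J ` ?X")
proof
  have lead: "form_eval (cubic_form_of g) (proj_x Infty) (proj_y Infty) \<noteq> 0"
    by (rule form_eval_Infty[OF deg])
  show "?T \<subseteq> ?J ` ?X"
  proof
    fix t assume "t \<in> ?T"
    then obtain E where t: "t = j_invariant E" and E: "compatible E g"
      unfolding compatible_j_invariants_def by blast
    from E consider c where "c \<noteq> 0" "isomorphic_curves E (cubic_curve (smult c g))"
      | a c where "c \<noteq> 0" "poly g a \<noteq> 0" "isomorphic_curves E (cubic_curve (smult c (recentre g a)))"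
      unfolding compatible_def by blast
    then have "\<exists>P \<in> ?X. j_invariant E = j_invariant (curve_at g P)"
    proof cases
      case 1
      then have "j_invariant E = j_invariant (curve_at g Infty)"
        using j_invariant_isomorphic[OF 1(2)] j_invariant_cubic_curve_smult[OF 1(1)] by simp
      then show ?thesis using lead by blast
    next
      case 2
      then have "j_invariant E = j_invariant (curve_at g (Pt a))"
        using j_invariant_isomorphic[OF 2(3)] j_invariant_cubic_curve_smult[OF 2(1)] by simp
      moreover have "Pt a \<in> ?X" using 2(2) poly_eq_form_eval[OF deg, of a] by simp
      ultimately show ?thesis by blast
    qed
    then show "t \<in> ?J ` ?X"
      unfolding t j_invariant_curve_at[OF deg two] by blast
  qed
  show "?J ` ?X \<subseteq> ?T"
  proof
    fix t assume "t \<in> ?J ` ?X"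
    then obtain P where P: "form_eval (cubic_form_of g) (proj_x P) (proj_y P) \<noteq> 0"
      and t: "t = j_invariant (curve_at g P)"
      unfolding j_invariant_curve_at[OF deg two] by blast
    have "(16::'a) \<noteq> 0" using power_not_zero[OF two, of 4] by simp
    then have "elliptic_curve (curve_at g P)"
      using P disc by (simp add: elliptic_curve_def wdisc_curve_at[OF deg])
    moreover have "compatible (curve_at g P) g"
    proof (cases P)
      case (Pt a)
      then have "poly g a \<noteq> 0" using P poly_eq_form_eval[OF deg, of a] by simp
      moreover have "isomorphic_curves (curve_at g P) (cubic_curve (smult 1 (recentre g a)))"
        by (simp add: Pt isomorphic_curves_refl)
      ultimately show ?thesis unfolding compatible_def by (metis one_neq_zero)
    next
      case Infty
      have "isomorphic_curves (curve_at g P) (cubic_curve (smult 1 g))"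
        by (simp add: Infty isomorphic_curves_refl)
      then show ?thesis unfolding compatible_def by (metis one_neq_zero)
    qed
    ultimately show "t \<in> ?T" unfolding compatible_j_invariants_def t by blast
  qed
qed

theorem theorem2p5:
  fixes f f1 f2 :: "'k::{field, finite} poly"
    and S :: "'k proj_line set" and T :: "'k set"
    and preimages :: "'k \<Rightarrow> 'k proj_line set"
  assumes "odd CHAR('k)"
    and "f = f1 * f2"
    and "separable_poly f"
    and "Polynomial.degree f = 6" "Polynomial.degree f1 = 3" "Polynomial.degree f2 = 3"
  defines "S \<equiv> Pt ` {a. poly f a = 0}"
    and "T \<equiv> compatible_j_invariants f1"
    and "preimages \<equiv> (\<lambda>t. {P \<in> UNIV - S. j_invariant (curve_at f1 P) = t})"
  shows "(\<forall>P \<in> UNIV - S. elliptic_curve (curve_at f1 P)) \<and>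
    (\<lambda>P. j_invariant (curve_at f1 P)) ` (UNIV - S) \<subseteq> T \<and>
    (\<exists>Exc. Exc \<subseteq> T \<and> card Exc \<le> 5 \<and>
       (\<forall>t \<in> T - Exc. card (preimages t) = num_root_auts f1) \<and>
       (\<forall>t \<in> Exc. card (preimages t) < num_root_auts f1))"
proof -
  define F where "F = cubic_form_of f1"
  define R where "R = {a. poly f2 a = 0}"
  let ?n = "num_root_auts f1"
  have two: "(2::'k) \<noteq> 0" by (rule two_neq_zero_of_odd_CHAR) fact
  have deg: "Polynomial.degree f1 = 3" by fact
  have sep: "separable_poly f1"
    using assms(2,3) separable_poly_factor by metis
  have disc: "form_disc F \<noteq> 0"
    unfolding F_def by (rule form_disc_separable) fact+
  have n: "?n = card (geometric_aut ` form_stabilizer F)"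
    unfolding F_def by (rule num_root_auts_eq) fact+
  have j: "j_invariant (curve_at f1 P) = form_j F P" for P
    unfolding F_def by (rule j_invariant_curve_at) fact+
  have T: "T = form_j F ` {P. form_eval F (proj_x P) (proj_y P) \<noteq> 0}"
    unfolding T_def F_def by (rule compatible_j_invariants_eq) (fact two deg disc[unfolded F_def])+
  \<comment> \<open>Removing the roots of \<open>f1\<close> is what makes the curves elliptic; only
    the roots of \<open>f2\<close> take points away from fibres.\<close>
  have S: "P \<notin> S \<longleftrightarrow> form_eval F (proj_x P) (proj_y P) \<noteq> 0 \<and> P \<notin> Pt ` R" for P
  proof (cases P)
    case (Pt a)
    then show ?thesis
      using poly_eq_form_eval[OF deg, of a] by (auto simp: S_def R_def F_def assms(2))
  next
    case Infty
    then show ?thesis using form_eval_Infty[OF deg] by (auto simp: S_def F_def)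
  qed
  have pre: "preimages t = form_j_fibre F t - Pt ` R" for t
  proof -
    have "preimages t = {P. P \<notin> S \<and> form_j F P = t}"
      unfolding preimages_def j by blast
    also have "\<dots> = form_j_fibre F t - Pt ` R"
      unfolding S form_j_fibre_def by blast
    finally show ?thesis .
  qed
  have fin: "finite (form_j_fibre F t)" for t
    by (rule finite_subset[OF _ finite_UNIV_proj_line]) simp
  have fibre_le: "card (form_j_fibre F t) \<le> ?n" for t
    unfolding n using card_form_j_fibre_le[OF two disc] card_form_j_fibre_0_le[OF two disc]
    by (cases "t = 0") simp_all
  have fibre_nonempty: "form_j_fibre F t \<noteq> {}" if "t \<in> T" for t
    using that unfolding T form_j_fibre_def by auto
  have fibre_eq: "card (form_j_fibre F t) = ?n" if "t \<in> T" "t \<noteq> 0" "t \<noteq> 1728" for t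
    unfolding n using that by (intro card_form_j_fibre_eq two disc fibre_nonempty)
  have pre_le: "card (preimages t) \<le> ?n" for t
    using card_mono[OF fin[of t], of "preimages t"] fibre_le[of t] unfolding pre by simp
  \<comment> \<open>Taking all values with too few preimages leaves only the size of the set to be
    bounded, as no fibre exceeds the number of automorphisms.\<close>
  define Exc where "Exc = {t \<in> T. card (preimages t) < ?n}"
  \<comment> \<open>Apart from 0 and 1728, a fibre can fall short only by losing a root of
    \<open>f2\<close>, and then its value is j at that root.\<close>
  have "Exc \<subseteq> {0, 1728} \<union> (\<lambda>a. form_j F (Pt a)) ` R"
  proof
    fix t assume t: "t \<in> Exc"
    show "t \<in> {0, 1728} \<union> (\<lambda>a. form_j F (Pt a)) ` R"
    proof (rule ccontr)
      assume neg: "t \<notin> {0, 1728} \<union> (\<lambda>a. form_j F (Pt a)) ` R"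
      then have "form_j_fibre F t \<inter> Pt ` R = {}"
        unfolding form_j_fibre_def by auto
      then have "preimages t = form_j_fibre F t" unfolding pre by blast
      with neg t fibre_eq[of t] show False by (simp add: Exc_def)
    qed
  qed
  then have "card Exc \<le> card ({0, 1728} \<union> (\<lambda>a. form_j F (Pt a)) ` R)"
    by (intro card_mono) simp_all
  also have "\<dots> \<le> card {0, 1728 :: 'k} + card ((\<lambda>a. form_j F (Pt a)) ` R)"
    by (rule card_Un_le)
  also have "\<dots> \<le> 2 + card R"
    by (intro add_mono card_image_le) (simp_all add: card_insert_le_m1)
  also have "card R \<le> 3"
  proof -
    have "f2 \<noteq> 0" using assms(6) by auto
    then show ?thesis using card_poly_roots_bound[of f2] assms(6) by (simp add: R_def)
  qed
  finally have card_Exc: "card Exc \<le> 5" by simp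
  have "elliptic_curve (curve_at f1 P)" if "P \<notin> S" for P
  proof -
    have "(16::'k) \<noteq> 0" using power_not_zero[OF two, of 4] by simp
    then show ?thesis
      using that disc by (simp add: S F_def elliptic_curve_def wdisc_curve_at[OF deg])
  qed
  moreover have "(\<lambda>P. j_invariant (curve_at f1 P)) ` (UNIV - S) \<subseteq> T"
    unfolding T j using S by auto
  moreover have "\<forall>t \<in> T - Exc. card (preimages t) = ?n"
    using pre_le by (auto simp: Exc_def intro: le_antisym)
  moreover have "Exc \<subseteq> T" "\<forall>t \<in> Exc. card (preimages t) < ?n"
    by (auto simp: Exc_def)
  ultimately show ?thesis
    using card_Exc by (intro conjI exI[of _ Exc]) simp_all
qed

end
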